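(* Let $\mathcal{H}$ be a nonzero complex Hilbert space and $n\geq 2$. Let $f\in OM_{1}$ be non-constant, and let $\Phi:\Delta_{n}\times B(\mathcal{H})_{+}^{n}\times\mathcal{H}\to\mathbb{R}^{+}$ satisfy $$\|\mathfrak{H}(\omega;\mathbb{A})\|\leq\sup_{\|x\|=1}\Phi(\omega;\mathbb{A};x)\leq\|\mathfrak{A}(\omega;\mathbb{A})\|$$ for all $\mathbb{A}\in B(\mathcal{H})_{+}^{n}$ and $\omega\in\Delta_{n}$. Then for all $\mathbb{T}=(T_{1},\dots,T_{n})\in B(\mathcal{H})_{sa}^{n}$ and $\omega=(w_{1},\dots,w_{n})\in\Delta_{n}$ the following are equivalent: (1) $\sum_{i=1}^{n}w_{i}T_{i}\leq 0$; (2) $\Phi(\omega;f(\lambda T_{1}+I),\dots,f(\lambda T_{n}+I);x)\leq 1$ for all sufficiently small $\lambda\geq 0$ and all unit vectors $x\in\mathcal{H}$.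
   Context: $B(\mathcal{H})$ is the algebra of bounded linear operators on $\mathcal{H}$ with operator norm $\|\cdot\|$, $I$ is the identity, $B(\mathcal{H})_{sa}$ is the set of self-adjoint operators, and $B(\mathcal{H})_{+}$ is the set of positive definite (positive and invertible) operators. For self-adjoint $A,B$, $A\leq B$ means $B-A$ is positive semi-definite. $\mathbb{R}^{+}=[0,\infty)$. $\Delta_{n}$ is the set of probability vectors: $\omega=(w_1,\dots,w_n)\in(0,1)^n$ with $\sum_k w_k=1$. A real-valued function $f$ on an interval $J$ is operator monotone if $A\leq B$ implies $f(A)\leq f(B)$ for all self-adjoint $A,B$ (on any complex Hilbert space) with spectra in $J$; $OM_{1}$ is the set of operator monotone functions $f:(0,\infty)\to(0,\infty)$ with $f(1)=1$. For $\mathbb{A}=(A_1,\dots,A_n)\in B(\mathcal{H})_+^n$, $\mathfrak{A}(\omega;\mathbb{A})=\sum_{i=1}^{n}w_{i}A_{i}$ and $\mathfrak{H}(\omega;\mathbb{A})=\left(\sum_{i=1}^{n}w_{i}A_{i}^{-1}\right)^{-1}$. In (2), "for all sufficiently small $\lambda\geq0$ and all unit vectors" means: there is $\lambda_0>0$ such that for all $\lambda\in[0,\lambda_0]$ the operators $\lambda T_i+I$ have spectra in $(0,\infty)$ and the inequality holds for every unit vector $x$. *)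

theory Defs
  imports "HOL-Analysis.Analysis" "HOL-Computational_Algebra.Polynomial"
begin

text \<open>
  A complex inner product space, presented on top of the real inner product space
  underlying it: the real inner product is the real part of the complex one. Hence
  the norm is \<open>sqrt (cinner x x)\<close>, and definiteness of \<^term>\<open>cinner\<close> is inherited from
  \<^class>\<open>real_inner\<close> (hermitian symmetry makes \<open>cinner x x\<close> real).
\<close>

class complex_inner = real_inner +
  fixes scaleC :: "complex \<Rightarrow> 'a \<Rightarrow> 'a"  (infixr \<open>*\<^sub>C\<close> 75)
    and cinner :: "'a \<Rightarrow> 'a \<Rightarrow> complex"
  assumes scaleC_add_right: "c *\<^sub>C (x + y) = c *\<^sub>C x + c *\<^sub>C y"
    and scaleC_add_left: "(c + d) *\<^sub>C x = c *\<^sub>C x + d *\<^sub>C x"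
    and scaleC_scaleC: "c *\<^sub>C d *\<^sub>C x = (c * d) *\<^sub>C x"
    and scaleC_of_real: "complex_of_real r *\<^sub>C x = r *\<^sub>R x"
    and cinner_commute: "cinner x y = cnj (cinner y x)"
    and cinner_add_left: "cinner (x + y) z = cinner x z + cinner y z"
    and cinner_scaleC_left: "cinner (c *\<^sub>C x) y = c * cinner x y"
    and inner_eq_Re_cinner: "inner x y = Re (cinner x y)"

class complex_hilbert = complex_inner + complete_space

text \<open>
  Bounded operators are elements of the library type of bounded real-linear maps that are
  moreover complex-linear; the norm of that type is the operator norm.
\<close>

definition clinear_op :: "('a::complex_hilbert \<Rightarrow>\<^sub>L 'a) \<Rightarrow> bool" where
  "clinear_op A \<longleftrightarrow> (\<forall>c x. blinfun_apply A (c *\<^sub>C x) = c *\<^sub>C blinfun_apply A x)"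

definition selfadjoint :: "('a::complex_hilbert \<Rightarrow>\<^sub>L 'a) \<Rightarrow> bool" where
  "selfadjoint A \<longleftrightarrow> clinear_op A \<and>
     (\<forall>x y. cinner (blinfun_apply A x) y = cinner x (blinfun_apply A y))"

definition pos_semidef :: "('a::complex_hilbert \<Rightarrow>\<^sub>L 'a) \<Rightarrow> bool" where
  "pos_semidef A \<longleftrightarrow> selfadjoint A \<and> (\<forall>x. 0 \<le> Re (cinner (blinfun_apply A x) x))"

definition op_le :: "('a::complex_hilbert \<Rightarrow>\<^sub>L 'a) \<Rightarrow> ('a \<Rightarrow>\<^sub>L 'a) \<Rightarrow> bool"
    (infix \<open>\<preceq>\<close> 50) where
  "A \<preceq> B \<longleftrightarrow> pos_semidef (B - A)"

definition is_op_inverse :: "('a::complex_hilbert \<Rightarrow>\<^sub>L 'a) \<Rightarrow> ('a \<Rightarrow>\<^sub>L 'a) \<Rightarrow> bool" where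
  "is_op_inverse A S \<longleftrightarrow> clinear_op S \<and> S o\<^sub>L A = id_blinfun \<and> A o\<^sub>L S = id_blinfun"

definition op_inverse :: "('a::complex_hilbert \<Rightarrow>\<^sub>L 'a) \<Rightarrow> ('a \<Rightarrow>\<^sub>L 'a)" where
  "op_inverse A = (THE S. is_op_inverse A S)"

definition pos_def :: "('a::complex_hilbert \<Rightarrow>\<^sub>L 'a) \<Rightarrow> bool" where
  "pos_def A \<longleftrightarrow> pos_semidef A \<and> (\<exists>S. is_op_inverse A S)"

text \<open>The equations below say that \<open>S\<close> is a two-sided inverse of \<open>A - z I\<close>.\<close>

definition spectrum :: "('a::complex_hilbert \<Rightarrow>\<^sub>L 'a) \<Rightarrow> complex set" where
  "spectrum A = {z. \<not> (\<exists>S. clinear_op S \<and>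
     (\<forall>x. blinfun_apply S (blinfun_apply A x - z *\<^sub>C x) = x \<and>
          blinfun_apply A (blinfun_apply S x) - z *\<^sub>C blinfun_apply S x = x))}"

definition op_poly :: "real poly \<Rightarrow> ('a::complex_hilbert \<Rightarrow>\<^sub>L 'a) \<Rightarrow> ('a \<Rightarrow>\<^sub>L 'a)" where
  "op_poly p A = (\<Sum>i\<le>degree p. coeff p i *\<^sub>R (((o\<^sub>L) A) ^^ i) id_blinfun)"

text \<open>
  For self-adjoint \<open>A\<close> and \<open>f\<close> continuous on the spectrum of \<open>A\<close>, \<open>fun_calc f A\<close> is the norm
  limit of \<open>p(A)\<close> as the polynomials \<open>p\<close> tend to \<open>f\<close> uniformly on the spectrum. The limit
  exists and is unique since the norm of \<open>p(A)\<close> is the supremum of \<open>\<bar>p\<bar>\<close> over the spectrum.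
  The value is unspecified if \<open>f\<close> is not continuous on the spectrum.
\<close>

definition fun_calc :: "(real \<Rightarrow> real) \<Rightarrow> ('a::complex_hilbert \<Rightarrow>\<^sub>L 'a) \<Rightarrow> ('a \<Rightarrow>\<^sub>L 'a)" where
  "fun_calc f A = (THE B. \<forall>e>0. \<exists>p.
     (\<forall>t. complex_of_real t \<in> spectrum A \<longrightarrow> \<bar>poly p t - f t\<bar> \<le> e) \<and>
     norm (op_poly p A - B) \<le> e)"

typedef ell2 = "{x :: nat \<Rightarrow> complex. summable (\<lambda>n. (cmod (x n))\<^sup>2)}"
  morphisms ell2_nth Abs_ell2
  by (rule exI[of _ "\<lambda>_. 0"]) simp

setup_lifting type_definition_ell2

lemma summable_ell2_add:
  fixes x y :: "nat \<Rightarrow> complex"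
  assumes "summable (\<lambda>n. (cmod (x n))\<^sup>2)" "summable (\<lambda>n. (cmod (y n))\<^sup>2)"
  shows "summable (\<lambda>n. (cmod (x n + y n))\<^sup>2)"
proof (rule summable_comparison_test')
  show "summable (\<lambda>n. 2 * (cmod (x n))\<^sup>2 + 2 * (cmod (y n))\<^sup>2)"
    using assms by (intro summable_add summable_mult)
  fix n
  have "(cmod (x n + y n))\<^sup>2 \<le> (cmod (x n) + cmod (y n))\<^sup>2"
    by (intro power_mono norm_triangle_ineq) auto
  also have "\<dots> \<le> 2 * (cmod (x n))\<^sup>2 + 2 * (cmod (y n))\<^sup>2"
    using sum_squares_bound[of "cmod (x n)" "cmod (y n)"] by (simp add: power2_sum)
  finally show "norm ((cmod (x n + y n))\<^sup>2) \<le> 2 * (cmod (x n))\<^sup>2 + 2 * (cmod (y n))\<^sup>2"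
    by simp
qed

lemma summable_ell2_scale:
  fixes x :: "nat \<Rightarrow> complex"
  assumes "summable (\<lambda>n. (cmod (x n))\<^sup>2)"
  shows "summable (\<lambda>n. (cmod (c * x n))\<^sup>2)"
  using summable_mult[OF assms, of "(cmod c)\<^sup>2"] by (simp add: norm_mult power_mult_distrib)

lemma summable_ell2_cinner:
  fixes x y :: "nat \<Rightarrow> complex"
  assumes "summable (\<lambda>n. (cmod (x n))\<^sup>2)" "summable (\<lambda>n. (cmod (y n))\<^sup>2)"
  shows "summable (\<lambda>n. x n * cnj (y n))"
proof (rule summable_comparison_test')
  show "summable (\<lambda>n. (cmod (x n))\<^sup>2 + (cmod (y n))\<^sup>2)"
    using assms by (rule summable_add)
  fix n
  have "2 * (cmod (x n) * cmod (y n)) \<le> (cmod (x n))\<^sup>2 + (cmod (y n))\<^sup>2"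
    using sum_squares_bound[of "cmod (x n)" "cmod (y n)"] by simp
  moreover have "0 \<le> cmod (x n) * cmod (y n)" by simp
  ultimately have "cmod (x n) * cmod (y n) \<le> (cmod (x n))\<^sup>2 + (cmod (y n))\<^sup>2" by linarith
  then show "norm (x n * cnj (y n)) \<le> (cmod (x n))\<^sup>2 + (cmod (y n))\<^sup>2"
    by (simp add: norm_mult)
qed

lemma summable_ell2_nth: "summable (\<lambda>n. (cmod (ell2_nth x n))\<^sup>2)"
  using ell2_nth[of x] by simp

instantiation ell2 :: complex_inner
begin

lift_definition zero_ell2 :: ell2 is "\<lambda>_. 0" by simp

lift_definition plus_ell2 :: "ell2 \<Rightarrow> ell2 \<Rightarrow> ell2" is "\<lambda>x y n. x n + y n"
  by (rule summable_ell2_add)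

lift_definition uminus_ell2 :: "ell2 \<Rightarrow> ell2" is "\<lambda>x n. - x n"
  by simp

lift_definition minus_ell2 :: "ell2 \<Rightarrow> ell2 \<Rightarrow> ell2" is "\<lambda>x y n. x n - y n"
  using summable_ell2_add[where y = "\<lambda>n. - y n" for y] by simp

lift_definition scaleC_ell2 :: "complex \<Rightarrow> ell2 \<Rightarrow> ell2" is "\<lambda>c x n. c * x n"
  by (rule summable_ell2_scale)

lift_definition scaleR_ell2 :: "real \<Rightarrow> ell2 \<Rightarrow> ell2" is "\<lambda>r x n. complex_of_real r * x n"
  by (rule summable_ell2_scale)

lift_definition cinner_ell2 :: "ell2 \<Rightarrow> ell2 \<Rightarrow> complex" is
  "\<lambda>x y. \<Sum>n. x n * cnj (y n)" .

definition inner_ell2 :: "ell2 \<Rightarrow> ell2 \<Rightarrow> real" where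
  "inner_ell2 x y = Re (cinner x y)"

definition norm_ell2 :: "ell2 \<Rightarrow> real" where
  "norm_ell2 x = sqrt (inner x x)"

definition sgn_ell2 :: "ell2 \<Rightarrow> ell2" where
  "sgn_ell2 x = inverse (norm x) *\<^sub>R x"

definition dist_ell2 :: "ell2 \<Rightarrow> ell2 \<Rightarrow> real" where
  "dist_ell2 x y = norm (x - y)"

definition uniformity_ell2 :: "(ell2 \<times> ell2) filter" where
  "uniformity_ell2 = (INF e\<in>{0<..}. principal {(x, y). dist x y < e})"

definition open_ell2 :: "ell2 set \<Rightarrow> bool" where
  "open_ell2 U \<longleftrightarrow> (\<forall>x\<in>U. eventually (\<lambda>(x', y). x' = x \<longrightarrow> y \<in> U) uniformity)"

instance
proof
  fix x y z :: ell2 and a b :: real and c d :: complex and U :: "ell2 set"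
  show "x + y + z = x + (y + z)" by transfer (simp add: add.assoc)
  show "x + y = y + x" by transfer (simp add: add.commute)
  show "0 + x = x" by transfer simp
  show "- x + x = 0" by transfer simp
  show "x - y = x + - y" by transfer simp
  show "a *\<^sub>R (x + y) = a *\<^sub>R x + a *\<^sub>R y" by transfer (simp add: distrib_left)
  show "(a + b) *\<^sub>R x = a *\<^sub>R x + b *\<^sub>R x" by transfer (simp add: distrib_right)
  show "a *\<^sub>R b *\<^sub>R x = (a * b) *\<^sub>R x" by transfer (simp add: mult.assoc)
  show "1 *\<^sub>R x = x" by transfer simp
  show "sgn x = inverse (norm x) *\<^sub>R x" by (rule sgn_ell2_def)
  show "dist x y = norm (x - y)" by (rule dist_ell2_def)
  show "uniformity = (INF e\<in>{0<..}. principal {(x::ell2, y). dist x y < e})"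
    by (rule uniformity_ell2_def)
  show "open U = (\<forall>x\<in>U. \<forall>\<^sub>F (x', y) in uniformity. x' = x \<longrightarrow> y \<in> U)"
    by (rule open_ell2_def)
  show "norm x = sqrt (inner x x)" by (rule norm_ell2_def)
  show "c *\<^sub>C (x + y) = c *\<^sub>C x + c *\<^sub>C y" by transfer (simp add: distrib_left)
  show "(c + d) *\<^sub>C x = c *\<^sub>C x + d *\<^sub>C x" by transfer (simp add: distrib_right)
  show "c *\<^sub>C d *\<^sub>C x = (c * d) *\<^sub>C x" by transfer (simp add: mult.assoc)
  show "complex_of_real a *\<^sub>C x = a *\<^sub>R x" by transfer simp
  show comm: "cinner x y = cnj (cinner y x)" for x y :: ell2
  proof transfer
    fix x y :: "nat \<Rightarrow> complex"
    assume "summable (\<lambda>n. (cmod (x n))\<^sup>2)" "summable (\<lambda>n. (cmod (y n))\<^sup>2)"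
    then have "(\<lambda>n. cnj (y n * cnj (x n))) sums cnj (\<Sum>n. y n * cnj (x n))"
      by (intro sums_cnj[THEN iffD2] summable_sums summable_ell2_cinner)
    then show "(\<Sum>n. x n * cnj (y n)) = cnj (\<Sum>n. y n * cnj (x n))"
      by (simp add: sums_iff mult.commute)
  qed
  show add: "cinner (x + y) z = cinner x z + cinner y z" for x y z :: ell2
    by transfer (simp add: distrib_right suminf_add summable_ell2_cinner)
  show scale: "cinner (c *\<^sub>C x) y = c * cinner x y" for c and x y :: ell2
    by transfer (simp add: mult.assoc suminf_mult summable_ell2_cinner)
  show re: "inner x y = Re (cinner x y)" for x y :: ell2 by (rule inner_ell2_def)
  show "inner x y = inner y x" unfolding re by (subst comm) simp
  show "inner (x + y) z = inner x z + inner y z" unfolding re add by simp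
  have "a *\<^sub>R x = complex_of_real a *\<^sub>C x" by transfer simp
  then show "inner (a *\<^sub>R x) y = a * inner x y" unfolding re by (simp add: scale)
  have inner_self: "inner x x = (\<Sum>n. (cmod (ell2_nth x n))\<^sup>2)"
  proof -
    have "(\<lambda>n. ell2_nth x n * cnj (ell2_nth x n)) sums cinner x x"
      unfolding cinner_ell2.rep_eq
      by (intro summable_sums summable_ell2_cinner summable_ell2_nth)
    from sums_Re[OF this] show ?thesis
      unfolding re by (simp add: sums_iff complex_norm_square[symmetric] flip: of_real_power)
  qed
  show "0 \<le> inner x x"
    unfolding inner_self by (intro suminf_nonneg summable_ell2_nth) simp
  have "(\<Sum>n. (cmod (ell2_nth x n))\<^sup>2) = 0 \<longleftrightarrow> (\<forall>n. (cmod (ell2_nth x n))\<^sup>2 = 0)"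
    by (intro suminf_eq_zero_iff summable_ell2_nth) simp
  also have "\<dots> \<longleftrightarrow> x = 0"
    by (auto simp: zero_ell2.rep_eq fun_eq_iff simp flip: ell2_nth_inject)
  finally show "inner x x = 0 \<longleftrightarrow> x = 0" unfolding inner_self .
qed

end

lemma norm_ell2_sums: "(\<lambda>n. (cmod (ell2_nth x n))\<^sup>2) sums (norm x)\<^sup>2"
proof -
  have "(\<lambda>n. ell2_nth x n * cnj (ell2_nth x n)) sums cinner x x"
    unfolding cinner_ell2.rep_eq
    by (intro summable_sums summable_ell2_cinner summable_ell2_nth)
  from sums_Re[OF this] show ?thesis
    by (simp add: power2_norm_eq_inner inner_eq_Re_cinner complex_norm_square[symmetric]
        flip: of_real_power)
qed

lemma sum_le_norm_ell2: "finite I \<Longrightarrow> (\<Sum>n\<in>I. (cmod (ell2_nth x n))\<^sup>2) \<le> (norm x)\<^sup>2"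
  using sum_le_suminf[OF summable_ell2_nth, of I x] norm_ell2_sums[of x]
  by (simp add: sums_iff)

instance ell2 :: complex_hilbert
proof
  fix X :: "nat \<Rightarrow> ell2"
  assume X: "Cauchy X"
  have coord: "cmod (ell2_nth x k) \<le> norm x" for x k
  proof -
    have "(\<Sum>n\<in>{k}. (cmod (ell2_nth x n))\<^sup>2) \<le> (norm x)\<^sup>2"
      by (rule sum_le_norm_ell2) simp
    then show ?thesis using power2_le_imp_le[of "cmod (ell2_nth x k)" "norm x"] by simp
  qed
  have "Cauchy (\<lambda>m. ell2_nth (X m) k)" for k
  proof (rule metric_CauchyI)
    fix e :: real assume "e > 0"
    then obtain M where M: "\<And>m n. m \<ge> M \<Longrightarrow> n \<ge> M \<Longrightarrow> norm (X m - X n) < e"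
      using X unfolding Cauchy_iff by blast
    show "\<exists>M. \<forall>m\<ge>M. \<forall>n\<ge>M. dist (ell2_nth (X m) k) (ell2_nth (X n) k) < e"
    proof (intro exI allI impI)
      fix m n assume "m \<ge> M" "n \<ge> M"
      then show "dist (ell2_nth (X m) k) (ell2_nth (X n) k) < e"
        using coord[of "X m - X n" k] M[of m n] by (simp add: dist_norm minus_ell2.rep_eq)
    qed
  qed
  then have "\<forall>k. \<exists>l. (\<lambda>m. ell2_nth (X m) k) \<longlonglongrightarrow> l"
    using Cauchy_convergent_iff convergent_def by metis
  then obtain L where L: "\<And>k. (\<lambda>m. ell2_nth (X m) k) \<longlonglongrightarrow> L k"
    by metis
  have bound: "summable (\<lambda>k. (cmod (ell2_nth (X m) k - L k))\<^sup>2) \<and>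
      (\<Sum>k. (cmod (ell2_nth (X m) k - L k))\<^sup>2) \<le> e\<^sup>2"
    if e: "e > 0" and M: "\<And>n. n \<ge> M \<Longrightarrow> norm (X m - X n) \<le> e" for e m M
  proof -
    have part: "(\<Sum>k<N. (cmod (ell2_nth (X m) k - L k))\<^sup>2) \<le> e\<^sup>2" for N
    proof (rule Lim_bounded)
      show "(\<lambda>n. \<Sum>k<N. (cmod (ell2_nth (X m) k - ell2_nth (X n) k))\<^sup>2)
              \<longlonglongrightarrow> (\<Sum>k<N. (cmod (ell2_nth (X m) k - L k))\<^sup>2)"
        by (intro tendsto_intros L)
      show "\<forall>n\<ge>M. (\<Sum>k<N. (cmod (ell2_nth (X m) k - ell2_nth (X n) k))\<^sup>2) \<le> e\<^sup>2"
      proof (intro allI impI)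
        fix n assume n: "n \<ge> M"
        have "(\<Sum>k<N. (cmod (ell2_nth (X m - X n) k))\<^sup>2) \<le> (norm (X m - X n))\<^sup>2"
          by (rule sum_le_norm_ell2) simp
        also have "\<dots> \<le> e\<^sup>2" using M[OF n] by (intro power_mono) auto
        finally show "(\<Sum>k<N. (cmod (ell2_nth (X m) k - ell2_nth (X n) k))\<^sup>2) \<le> e\<^sup>2"
          by (simp add: minus_ell2.rep_eq)
      qed
    qed
    have "summable (\<lambda>k. (cmod (ell2_nth (X m) k - L k))\<^sup>2)"
      by (rule summableI_nonneg_bounded[OF _ part]) simp
    moreover from this have "(\<Sum>k. (cmod (ell2_nth (X m) k - L k))\<^sup>2) \<le> e\<^sup>2"
      by (rule suminf_le_const[OF _ part])
    ultimately show ?thesis by blast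
  qed
  have "\<exists>M. \<forall>m\<ge>M. \<forall>n\<ge>M. norm (X m - X n) < 1"
    using X unfolding Cauchy_iff by (meson zero_less_one)
  then obtain M1 where M1: "\<And>m n. m \<ge> M1 \<Longrightarrow> n \<ge> M1 \<Longrightarrow> norm (X m - X n) < 1"
    by blast
  have "summable (\<lambda>k. (cmod (ell2_nth (X M1) k - L k))\<^sup>2)"
    using bound[of 1 M1 M1] M1 by (simp add: less_imp_le)
  then have "summable (\<lambda>k. (cmod (ell2_nth (X M1) k - L k + - ell2_nth (X M1) k))\<^sup>2)"
    by (intro summable_ell2_add) (simp_all add: summable_ell2_nth)
  then have sumL: "summable (\<lambda>k. (cmod (L k))\<^sup>2)" by simp
  define l where "l = Abs_ell2 L"
  have nth_l: "ell2_nth l = L"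
    unfolding l_def using sumL by (simp add: Abs_ell2_inverse)
  have "X \<longlonglongrightarrow> l"
  proof (rule LIMSEQ_I)
    fix e :: real assume e: "e > 0"
    then obtain M where M: "\<And>m n. m \<ge> M \<Longrightarrow> n \<ge> M \<Longrightarrow> norm (X m - X n) < e / 2"
      using X unfolding Cauchy_iff by (meson half_gt_zero)
    show "\<exists>M. \<forall>n\<ge>M. norm (X n - l) < e"
    proof (intro exI allI impI)
      fix m assume m: "m \<ge> M"
      have "(\<Sum>k. (cmod (ell2_nth (X m) k - L k))\<^sup>2) \<le> (e / 2)\<^sup>2"
        using bound[of "e / 2" M m] M[OF m] e by (simp add: less_imp_le)
      moreover have "(\<Sum>k. (cmod (ell2_nth (X m) k - L k))\<^sup>2) = (norm (X m - l))\<^sup>2"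
        using norm_ell2_sums[of "X m - l"] by (simp add: sums_iff minus_ell2.rep_eq nth_l)
      ultimately have "(norm (X m - l))\<^sup>2 \<le> (e / 2)\<^sup>2" by (simp only:)
      then have "norm (X m - l) \<le> e / 2"
        by (rule power2_le_imp_le) (use e in simp)
      then show "norm (X m - l) < e" using e by simp
    qed
  qed
  then show "convergent X" by (rule convergentI)
qed

definition operator_monotone_in :: "'h::complex_hilbert itself \<Rightarrow> real set \<Rightarrow> (real \<Rightarrow> real) \<Rightarrow> bool"
  where
  "operator_monotone_in _ J f \<longleftrightarrow> (\<forall>A B :: 'h \<Rightarrow>\<^sub>L 'h.
     selfadjoint A \<longrightarrow> selfadjoint B \<longrightarrow>
     spectrum A \<subseteq> complex_of_real ` J \<longrightarrow> spectrum B \<subseteq> complex_of_real ` J \<longrightarrow>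
     A \<preceq> B \<longrightarrow> fun_calc f A \<preceq> fun_calc f B)"

text \<open>
  HOL cannot quantify over all Hilbert spaces (types) inside a formula. Monotonicity is
  required for operators on the sequence space; extending by a scalar in \<open>J\<close> on the orthogonal
  complement, this covers every separable Hilbert space, in particular matrices of all sizes.
  Anything operator monotone on all Hilbert spaces is operator monotone in this sense, so
  assuming only this is at most a weaker hypothesis.
\<close>

definition operator_monotone :: "real set \<Rightarrow> (real \<Rightarrow> real) \<Rightarrow> bool" where
  "operator_monotone J f \<longleftrightarrow> operator_monotone_in TYPE(ell2) J f"

definition OM1 :: "(real \<Rightarrow> real) set" where
  "OM1 = {f. (\<forall>t>0. 0 < f t) \<and> f 1 = 1 \<and> operator_monotone {0<..} f}"

definition prob_vectors :: "(real ^ 'n::finite) set" where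
  "prob_vectors = {w. (\<forall>i. 0 < w $ i \<and> w $ i < 1) \<and> (\<Sum>i\<in>UNIV. w $ i) = 1}"

definition arith_mean ::
    "real ^ 'n::finite \<Rightarrow> ('a::complex_hilbert \<Rightarrow>\<^sub>L 'a) ^ 'n \<Rightarrow> ('a \<Rightarrow>\<^sub>L 'a)" where
  "arith_mean w A = (\<Sum>i\<in>UNIV. (w $ i) *\<^sub>R (A $ i))"

definition harm_mean ::
    "real ^ 'n::finite \<Rightarrow> ('a::complex_hilbert \<Rightarrow>\<^sub>L 'a) ^ 'n \<Rightarrow> ('a \<Rightarrow>\<^sub>L 'a)" where
  "harm_mean w A = op_inverse (\<Sum>i\<in>UNIV. (w $ i) *\<^sub>R op_inverse (A $ i))"

end

(* An operator monotone f on (0, oo) is concave, differentiable at 1, and has slope c = f'(1) > 0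
   unless it is constant. So f(t) <= 1 + c (t - 1) for all t > 0, hence f(I + r T_i) <= I + r c T_i,
   and the arithmetic mean is at most I + r c (sum w_i T_i). Conversely
   1 / f(t) <= 1 - c (t - 1) + o(t - 1), so if the harmonic mean has norm at most 1, then
   I <= sum w_i f(I + r T_i)^(-1) <= I - r c (sum w_i T_i) + o(r).

   The scalar facts about f follow from operators with two eigenvalues on the sequence space.
   Comparing a rotated diagonal 2x2 block with a larger diagonal one gives concavity and the Loewner
   inequality (f y - f x)^2 <= sigma tau (y - x)^2 for supergradients sigma at x and tau at y; the
   latter makes the one-sided derivatives equal and forces f to be constant where the slope is 0.

   For the functional calculus one needs the norm of p(A) to be at most the supremum of |p| over the
   spectrum: with N the norm of p(A), p(A)^2 - N^2 is not bounded below, whereas a real polynomial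
   without roots in the spectrum is, as a product of linear and irreducible quadratic factors. *)

theory Submission
  imports Defs "HOL-Computational_Algebra.Fundamental_Theorem_Algebra"
begin

section \<open>Operators on a complex Hilbert space\<close>

text \<open>Monotonicity of \<open>f\<close> is known for operators on \<open>ell2\<close> only,
  whereas the \<open>T $ i\<close> act on an arbitrary complex Hilbert space. It is therefore never
  applied to them: it is spent on scalar facts about \<open>f\<close>, and these reach the operators
  through the order properties of the functional calculus. The calculus itself is built without
  square roots of positive operators and without spectral measures: coercive operators are inverted
  by a contraction argument, this locates the spectrum, and the order is read off norm bounds. Where
  a square root would be customary, Cauchy-Schwarz for the form of a positive operator takes its
  place. The two directions are asymmetric. The tangent line at 1 dominates \<open>f\<close> on the
  whole half-line, so the bound for the arithmetic mean is exact for every admissible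
  \<open>r\<close>. The reciprocal of \<open>f\<close> is controlled only up to a small multiple of
  \<open>r\<close>, so there \<open>r\<close> is chosen after the vector \<open>x\<close> and the
  tolerance, which is harmless because the conclusion does not contain \<open>r\<close>.\<close>

lemma scaleC_scaleR_commute: "c *\<^sub>C (r *\<^sub>R (x::'a::complex_inner)) = r *\<^sub>R (c *\<^sub>C x)"
  by (metis mult.commute scaleC_of_real scaleC_scaleC)

lemma scaleC_zero_right [simp]: "c *\<^sub>C (0::'a::complex_inner) = 0"
  using scaleC_add_right[of c 0 "0::'a"] by simp

lemma scaleC_minus_right: "c *\<^sub>C (- x::'a::complex_inner) = - (c *\<^sub>C x)"
  using scaleC_scaleR_commute[of c "-1" x] by simp

lemma scaleC_diff_right: "c *\<^sub>C (x - y::'a::complex_inner) = c *\<^sub>C x - c *\<^sub>C y"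
  using scaleC_add_right[of c x "- y"] by (simp add: scaleC_minus_right)

lemma scaleC_split: "c *\<^sub>C (x::'a::complex_inner) = Re c *\<^sub>R x + Im c *\<^sub>R (\<i> *\<^sub>C x)"
proof -
  have "c *\<^sub>C x = (complex_of_real (Re c) + complex_of_real (Im c) * \<i>) *\<^sub>C x"
    by (metis complex_eq mult.commute)
  then show ?thesis
    by (simp only: scaleC_add_left scaleC_scaleC[symmetric] scaleC_of_real)
qed

lemma cinner_add_right: "cinner z (x + y) = cinner z x + cinner z (y::'a::complex_inner)"
  by (metis cinner_add_left cinner_commute complex_cnj_add)

lemma cinner_scaleC_right: "cinner x (c *\<^sub>C y) = cnj c * cinner x (y::'a::complex_inner)"
  by (metis cinner_commute cinner_scaleC_left complex_cnj_mult)

lemma norm_scaleC: "norm (c *\<^sub>C (x::'a::complex_inner)) = cmod c * norm x"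
proof -
  have "inner (c *\<^sub>C x) (c *\<^sub>C x) = (cmod c)\<^sup>2 * inner x x"
  proof -
    have "cinner (c *\<^sub>C x) (c *\<^sub>C x) = (c * cnj c) * cinner x x"
      by (simp add: cinner_scaleC_left cinner_scaleC_right)
    also have "c * cnj c = complex_of_real ((cmod c)\<^sup>2)"
      by (rule complex_norm_square[symmetric])
    finally show ?thesis
      by (simp add: inner_eq_Re_cinner del: of_real_power)
  qed
  then show ?thesis
    by (simp add: norm_eq_sqrt_inner real_sqrt_mult)
qed

lemma inner_i_left: "inner (\<i> *\<^sub>C x) (y::'a::complex_inner) = - Im (cinner x y)"
  by (simp add: inner_eq_Re_cinner cinner_scaleC_left)

text \<open>The real inner product already contains both parts of the complex one:
  \<open>c = 1\<close> yields the real part and \<open>c = \<i>\<close> minus the imaginary part.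
  Adjoint identities therefore need to be checked for \<open>inner\<close> only.\<close>

lemma cinner_eqI:
  assumes "\<And>c. inner (c *\<^sub>C x) y = inner (c *\<^sub>C x') (y'::'a::complex_inner)"
  shows "cinner x y = cinner x' y'"
  using assms[of 1] assms[of \<i>] unfolding inner_i_left
  by (auto simp: inner_eq_Re_cinner cinner_scaleC_left intro!: complex_eqI)

lemma selfadjoint_iff:
  "selfadjoint A \<longleftrightarrow> clinear_op A \<and> (\<forall>x y. inner (blinfun_apply A x) y = inner x (blinfun_apply A y))"
proof
  assume "selfadjoint A" then show "clinear_op A \<and> (\<forall>x y. inner (blinfun_apply A x) y = inner x (blinfun_apply A y))"
    unfolding selfadjoint_def by (simp add: inner_eq_Re_cinner)
next
  assume *: "clinear_op A \<and> (\<forall>x y. inner (blinfun_apply A x) y = inner x (blinfun_apply A y))"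
  show "selfadjoint A"
    unfolding selfadjoint_def
  proof (intro conjI allI)
    show "clinear_op A" using * by simp
    fix x y
    show "cinner (blinfun_apply A x) y = cinner x (blinfun_apply A y)"
    proof (rule cinner_eqI)
      fix c
      show "inner (c *\<^sub>C blinfun_apply A x) y = inner (c *\<^sub>C x) (blinfun_apply A y)"
        using * unfolding clinear_op_def by metis
    qed
  qed
qed

lemma selfadjoint_clinear: "selfadjoint A \<Longrightarrow> clinear_op A"
  by (simp add: selfadjoint_def)

lemma selfadjoint_inner: "selfadjoint A \<Longrightarrow> inner (blinfun_apply A x) y = inner x (blinfun_apply A y)"
  by (simp add: selfadjoint_iff)

lemma pos_semidef_iff: "pos_semidef A \<longleftrightarrow> selfadjoint A \<and> (\<forall>x. 0 \<le> inner (blinfun_apply A x) x)"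
  by (simp add: pos_semidef_def inner_eq_Re_cinner)

section \<open>Closure properties of complex-linear and self-adjoint operators\<close>

lemma clinear_op_id [simp]: "clinear_op id_blinfun"
  by (simp add: clinear_op_def)

lemma clinear_op_0 [simp]: "clinear_op 0"
  by (simp add: clinear_op_def)

lemma clinear_op_add: "clinear_op A \<Longrightarrow> clinear_op B \<Longrightarrow> clinear_op (A + B)"
  by (simp add: clinear_op_def blinfun.add_left scaleC_add_right)

lemma clinear_op_scaleR: "clinear_op A \<Longrightarrow> clinear_op (r *\<^sub>R A)"
  by (simp add: clinear_op_def blinfun.scaleR_left scaleC_scaleR_commute)

lemma clinear_op_diff: "clinear_op A \<Longrightarrow> clinear_op B \<Longrightarrow> clinear_op (A - B)"
  by (simp add: clinear_op_def blinfun.diff_left scaleC_diff_right)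

lemma clinear_op_compose: "clinear_op A \<Longrightarrow> clinear_op B \<Longrightarrow> clinear_op (A o\<^sub>L B)"
  by (simp add: clinear_op_def)

lemma selfadjoint_id [simp]: "selfadjoint id_blinfun"
  by (simp add: selfadjoint_iff)

lemma selfadjoint_0 [simp]: "selfadjoint 0"
  by (simp add: selfadjoint_iff)

lemma selfadjoint_add: "selfadjoint A \<Longrightarrow> selfadjoint B \<Longrightarrow> selfadjoint (A + B)"
  by (simp add: selfadjoint_iff clinear_op_add blinfun.add_left inner_add_left inner_add_right)

lemma selfadjoint_diff: "selfadjoint A \<Longrightarrow> selfadjoint B \<Longrightarrow> selfadjoint (A - B)"
  by (simp add: selfadjoint_iff clinear_op_diff blinfun.diff_left inner_diff_left inner_diff_right)

lemma selfadjoint_scaleR: "selfadjoint A \<Longrightarrow> selfadjoint (r *\<^sub>R A)"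
  by (simp add: selfadjoint_iff clinear_op_scaleR blinfun.scaleR_left)

lemma selfadjoint_sum: "(\<And>i. i \<in> I \<Longrightarrow> selfadjoint (A i)) \<Longrightarrow> selfadjoint (\<Sum>i\<in>I. A i)"
  by (induction I rule: infinite_finite_induct) (auto intro: selfadjoint_add)

lemma selfadjoint_compose:
  assumes "selfadjoint A" "selfadjoint B" "A o\<^sub>L B = B o\<^sub>L A"
  shows "selfadjoint (A o\<^sub>L B)"
  unfolding selfadjoint_iff
proof (intro conjI allI)
  show "clinear_op (A o\<^sub>L B)"
    using assms by (intro clinear_op_compose selfadjoint_clinear)
  fix x y
  have "inner (blinfun_apply (A o\<^sub>L B) x) y = inner x (blinfun_apply (B o\<^sub>L A) y)"
    by (simp only: blinfun_apply_blinfun_compose selfadjoint_inner[OF assms(1)]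
        selfadjoint_inner[OF assms(2)])
  then show "inner (blinfun_apply (A o\<^sub>L B) x) y = inner x (blinfun_apply (A o\<^sub>L B) y)"
    using assms(3) by simp
qed

lemma selfadjoint_limit:
  assumes "\<And>n. selfadjoint (A n)" "A \<longlonglongrightarrow> B"
  shows "selfadjoint B"
  unfolding selfadjoint_iff clinear_op_def
proof (intro conjI allI)
  have lim: "(\<lambda>n. blinfun_apply (A n) x) \<longlonglongrightarrow> blinfun_apply B x" for x
    using assms(2) by (intro tendsto_intros)
  fix c x
  have "bounded_linear (\<lambda>y::'a. c *\<^sub>C y)"
    by (rule bounded_linear_intro[where K = "cmod c"])
      (simp_all add: scaleC_add_right scaleC_scaleR_commute norm_scaleC)
  from bounded_linear.tendsto[OF this lim[of x]]
  have "(\<lambda>n. blinfun_apply (A n) (c *\<^sub>C x)) \<longlonglongrightarrow> c *\<^sub>C blinfun_apply B x"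
    using assms(1) by (simp add: selfadjoint_def clinear_op_def)
  then show "blinfun_apply B (c *\<^sub>C x) = c *\<^sub>C blinfun_apply B x"
    using LIMSEQ_unique lim by blast
next
  have lim: "(\<lambda>n. blinfun_apply (A n) x) \<longlonglongrightarrow> blinfun_apply B x" for x
    using assms(2) by (intro tendsto_intros)
  fix x y
  have "(\<lambda>n. inner (blinfun_apply (A n) x) y) \<longlonglongrightarrow> inner (blinfun_apply B x) y"
    by (intro tendsto_intros lim)
  moreover have "(\<lambda>n. inner x (blinfun_apply (A n) y)) \<longlonglongrightarrow> inner x (blinfun_apply B y)"
    by (intro tendsto_intros lim)
  ultimately show "inner (blinfun_apply B x) y = inner x (blinfun_apply B y)"
    using assms(1) LIMSEQ_unique by (simp add: selfadjoint_inner)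
qed

section \<open>Quadratic forms, coercivity and inverses\<close>

lemma pos_semidef_cauchy_schwarz:
  assumes "pos_semidef A"
  shows "(inner (blinfun_apply A x) y)\<^sup>2 \<le> inner (blinfun_apply A x) x * inner (blinfun_apply A y) y"
proof -
  let ?a = "inner (blinfun_apply A y) y" and ?b = "inner (blinfun_apply A x) y"
    and ?c = "inner (blinfun_apply A x) x"
  have sym: "inner (blinfun_apply A y) x = ?b"
    using assms by (metis inner_commute pos_semidef_iff selfadjoint_inner)
  have nn: "0 \<le> ?c + 2 * s * ?b + s\<^sup>2 * ?a" for s
  proof -
    have "0 \<le> inner (blinfun_apply A (x + s *\<^sub>R y)) (x + s *\<^sub>R y)"
      using assms by (simp add: pos_semidef_iff)
    also have "\<dots> = ?c + 2 * s * ?b + s\<^sup>2 * ?a"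
      by (simp add: blinfun.add_right blinfun.scaleR_right inner_add_left inner_add_right sym
          power2_eq_square algebra_simps)
    finally show ?thesis .
  qed
  have a: "?a \<ge> 0" using assms by (simp add: pos_semidef_iff)
  show ?thesis
  proof (cases "?a = 0")
    case True
    have "?b = 0"
    proof (rule ccontr)
      assume b: "?b \<noteq> 0"
      \<comment> \<open>With \<open>?a = 0\<close> the expression in \<open>nn\<close> is affine in
        \<open>s\<close>; this \<open>s\<close> brings it down to -1.\<close>
      have "0 \<le> ?c + 2 * (- (?c + 1) / (2 * ?b)) * ?b" using nn[of "- (?c + 1) / (2 * ?b)"] True by simp
      also have "\<dots> = -1" using b by (simp add: field_simps)
      finally show False by simp
    qed
    then show ?thesis using True by simp
  next
    case False
    \<comment> \<open>This \<open>s\<close> minimises the quadratic in \<open>nn\<close>.\<close>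
    have "0 \<le> ?c + 2 * (- ?b / ?a) * ?b + (- ?b / ?a)\<^sup>2 * ?a" by (rule nn)
    also have "\<dots> = ?c - ?b\<^sup>2 / ?a"
      using False by (simp add: field_simps power2_eq_square)
    finally show ?thesis
      using False a by (simp add: field_simps)
  qed
qed

text \<open>The argument of Lax and Milgram: a solution of \<open>K x = y\<close> is a fixed point
  of \<open>x - t (K x - y)\<close>, which is a contraction for suitable \<open>t > 0\<close>.
  Self-adjointness is not involved.\<close>

lemma clinear_op_inverse_ex:
  fixes K :: "'a::complex_hilbert \<Rightarrow>\<^sub>L 'a"
  assumes K: "clinear_op K" and m: "m > 0"
    and coer: "\<And>x. m * (norm x)\<^sup>2 \<le> inner (blinfun_apply K x) x"
  obtains S where "is_op_inverse K S"
proof -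
  have below: "m * norm x \<le> norm (blinfun_apply K x)" for x
  proof (cases "x = 0")
    case False
    have "m * norm x * norm x \<le> norm (blinfun_apply K x) * norm x"
      using coer[of x] norm_cauchy_schwarz[of "blinfun_apply K x" x]
      by (simp add: power2_eq_square mult.assoc)
    then show ?thesis using False by simp
  qed simp
  \<comment> \<open>\<open>M\<close> bounds the norm of \<open>K\<close>, is positive, and is at
    least \<open>m\<close>, so that the radicand in \<open>c\<close> is nonnegative.\<close>
  define M where "M = norm K + m"
  have M: "M > 0" "M \<ge> norm K" "M \<ge> m" using m by (auto simp: M_def add_nonneg_pos)
  define c where "c = sqrt (1 - m\<^sup>2 / M\<^sup>2)"
  have q: "0 < m\<^sup>2 / M\<^sup>2" "m\<^sup>2 / M\<^sup>2 \<le> 1" using m M by (auto simp: power_mono)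
  have c: "0 \<le> c" "c < 1" using q by (auto simp: c_def)
  \<comment> \<open>The minimiser of \<open>1 - 2 * t * m + t\<^sup>2 * M\<^sup>2\<close>, which
    bounds the squared contraction factor; the minimum is the square of \<open>c\<close>.\<close>
  define t where "t = m / M\<^sup>2"
  have contr: "norm (x - t *\<^sub>R blinfun_apply K x) \<le> c * norm x" for x
  proof -
    have "(norm (x - t *\<^sub>R blinfun_apply K x))\<^sup>2
        = (norm x)\<^sup>2 - 2 * t * inner (blinfun_apply K x) x + t\<^sup>2 * (norm (blinfun_apply K x))\<^sup>2"
      unfolding power2_norm_eq_inner inner_diff_left inner_diff_right inner_scaleR_left
        inner_scaleR_right inner_commute[of x "blinfun_apply K x"]
      by (simp add: power2_eq_square right_diff_distrib mult.assoc)
    also have "\<dots> \<le> (norm x)\<^sup>2 - 2 * t * (m * (norm x)\<^sup>2) + t\<^sup>2 * (M * norm x)\<^sup>2"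
    proof (intro add_mono diff_mono mult_left_mono power_mono)
      show "norm (blinfun_apply K x) \<le> M * norm x"
        using norm_blinfun[of K x] M(2) by (meson mult_right_mono norm_ge_zero order_trans)
    qed (use coer m M in \<open>auto simp: t_def\<close>)
    also have "\<dots> = (1 - m\<^sup>2 / M\<^sup>2) * (norm x)\<^sup>2"
      using M(1) by (simp add: t_def power2_eq_square field_simps)
    also have "\<dots> = (c * norm x)\<^sup>2"
      using q by (simp add: c_def power_mult_distrib)
    finally show ?thesis
      by (rule power2_le_imp_le) (use c in simp)
  qed
  have t: "t > 0" using m M by (simp add: t_def)
  have surj: "\<exists>x. blinfun_apply K x = y" for y
  proof -
    have "\<exists>!x. x - t *\<^sub>R (blinfun_apply K x - y) = x"
    proof (rule banach_fix_type[OF c], intro allI)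
      fix x z
      have "(x - t *\<^sub>R (blinfun_apply K x - y)) - (z - t *\<^sub>R (blinfun_apply K z - y))
          = (x - z) - t *\<^sub>R blinfun_apply K (x - z)"
        by (simp add: blinfun.diff_right algebra_simps)
      then show "dist (x - t *\<^sub>R (blinfun_apply K x - y)) (z - t *\<^sub>R (blinfun_apply K z - y))
          \<le> c * dist x z"
        unfolding dist_norm by (metis contr)
    qed
    then show ?thesis using t by auto
  qed
  have inj: "x = z" if "blinfun_apply K x = blinfun_apply K z" for x z
    using below[of "x - z"] that m by (simp add: blinfun.diff_right mult_le_0_iff)
  define g where "g y = (THE x. blinfun_apply K x = y)" for y
  have g: "blinfun_apply K (g y) = y" for y
    unfolding g_def by (rule theI') (use surj inj in blast)
  have gK: "g (blinfun_apply K x) = x" for x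
    using g inj by blast
  have "bounded_linear g"
  proof (rule bounded_linear_intro[where K = "1 / m"])
    show "g (x + y) = g x + g y" for x y
      by (rule inj) (simp add: g blinfun.add_right)
    show "g (r *\<^sub>R x) = r *\<^sub>R g x" for r x
      by (rule inj) (simp add: g blinfun.scaleR_right)
    show "norm (g x) \<le> norm x * (1 / m)" for x
      using below[of "g x"] m by (simp add: g field_simps)
  qed
  then have app: "blinfun_apply (Blinfun g) = g" by (rule bounded_linear_Blinfun_apply)
  have "is_op_inverse K (Blinfun g)"
    unfolding is_op_inverse_def clinear_op_def
  proof (intro conjI allI blinfun_eqI)
    show "blinfun_apply (Blinfun g) (c *\<^sub>C x) = c *\<^sub>C blinfun_apply (Blinfun g) x" for c x
      unfolding app by (rule inj) (use K in \<open>simp add: clinear_op_def g\<close>)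
  qed (simp_all add: app g gK)
  then show thesis by (rule that)
qed

lemma op_inverse_eq:
  assumes "is_op_inverse A S"
  shows "op_inverse A = S"
  unfolding op_inverse_def
proof (rule the_equality)
  show "is_op_inverse A S" by (rule assms)
  fix R assume R: "is_op_inverse A R"
  have "blinfun_apply R x = blinfun_apply S x" for x
  proof -
    have "blinfun_apply (R o\<^sub>L A) (blinfun_apply S x) = blinfun_apply S x"
      using R by (simp add: is_op_inverse_def)
    moreover have "blinfun_apply (A o\<^sub>L S) x = x"
      using assms by (simp add: is_op_inverse_def)
    ultimately show ?thesis by simp
  qed
  then show "R = S" by (rule blinfun_eqI)
qed

section \<open>The spectrum of a self-adjoint operator\<close>

text \<open>For a self-adjoint operator this is the whole spectrum, seen as a set of reals on which
  real polynomials and \<open>f\<close> can be evaluated.\<close>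

definition real_spectrum :: "('a::complex_hilbert \<Rightarrow>\<^sub>L 'a) \<Rightarrow> real set" where
  "real_spectrum A = {t. complex_of_real t \<in> spectrum A}"

text \<open>The hypothesis says that \<open>(A - z)(A - cnj z)\<close>, which is
  \<open>(A - Re z)\<^sup>2 + (Im z)\<^sup>2\<close>, is coercive. This product is thus invertible,
  and since the factors commute, so is \<open>A - z\<close>. One criterion serves for real and
  nonreal \<open>z\<close>.\<close>

lemma not_in_spectrum_of_square:
  fixes A :: "'a::complex_hilbert \<Rightarrow>\<^sub>L 'a"
  assumes A: "selfadjoint A" and m: "m > 0"
    and below: "\<And>x. m * (norm x)\<^sup>2 \<le>
      (norm (blinfun_apply A x - Re z *\<^sub>R x))\<^sup>2 + (Im z)\<^sup>2 * (norm x)\<^sup>2"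
  shows "z \<notin> spectrum A"
proof -
  \<comment> \<open>Scalars of the operator type are real, so multiplication by \<open>\<i>\<close>
    has to be supplied as an operator.\<close>
  define J where "J = Blinfun (\<lambda>x::'a. \<i> *\<^sub>C x)"
  have "bounded_linear (\<lambda>x::'a. \<i> *\<^sub>C x)"
    by (rule bounded_linear_intro[where K = 1])
      (simp_all add: scaleC_add_right scaleC_scaleR_commute norm_scaleC)
  then have J: "blinfun_apply J x = \<i> *\<^sub>C x" for x
    unfolding J_def by (simp add: bounded_linear_Blinfun_apply)
  have Jc: "clinear_op J"
    unfolding clinear_op_def J by (simp add: scaleC_scaleC mult.commute)
  define D where "D = A - Re z *\<^sub>R id_blinfun"
  have D: "blinfun_apply D x = blinfun_apply A x - Re z *\<^sub>R x" for x
    by (simp add: D_def blinfun.diff_left blinfun.scaleR_left)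
  have Dsa: "selfadjoint D"
    unfolding D_def by (intro selfadjoint_diff selfadjoint_scaleR selfadjoint_id A)
  have Dc: "blinfun_apply D (c *\<^sub>C x) = c *\<^sub>C blinfun_apply D x" for c x
    using Dsa by (simp add: selfadjoint_def clinear_op_def)
  define Q where "Q = (D o\<^sub>L D) + (Im z)\<^sup>2 *\<^sub>R id_blinfun"
  have Q: "blinfun_apply Q x = blinfun_apply D (blinfun_apply D x) + (Im z)\<^sup>2 *\<^sub>R x" for x
    by (simp add: Q_def blinfun.add_left blinfun.scaleR_left)
  have "clinear_op Q"
    unfolding Q_def by (intro clinear_op_add clinear_op_compose clinear_op_scaleR
        selfadjoint_clinear Dsa selfadjoint_id)
  moreover have "m * (norm x)\<^sup>2 \<le> inner (blinfun_apply Q x) x" for x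
    using below[of x] selfadjoint_inner[OF Dsa, of "blinfun_apply D x" x]
    by (simp add: Q inner_add_left power2_norm_eq_inner D[symmetric])
  ultimately obtain S where S: "is_op_inverse Q S"
    using clinear_op_inverse_ex[OF _ m] by blast
  have SQ: "blinfun_apply S (blinfun_apply Q x) = x" for x
    using S unfolding is_op_inverse_def by (metis blinfun_apply_blinfun_compose blinfun_apply_id_blinfun id_apply)
  have QS: "blinfun_apply Q (blinfun_apply S x) = x" for x
    using S unfolding is_op_inverse_def by (metis blinfun_apply_blinfun_compose blinfun_apply_id_blinfun id_apply)
  define V where "V = D - Im z *\<^sub>R J"
  define W where "W = D + Im z *\<^sub>R J"
  have V: "blinfun_apply V x = blinfun_apply A x - z *\<^sub>C x" for x
    by (subst scaleC_split) (simp add: V_def D J blinfun.diff_left blinfun.scaleR_left)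
  have W: "blinfun_apply W x = blinfun_apply D x + Im z *\<^sub>R (\<i> *\<^sub>C x)" for x
    by (simp add: W_def J blinfun.add_left blinfun.scaleR_left)
  have V': "blinfun_apply V x = blinfun_apply D x - Im z *\<^sub>R (\<i> *\<^sub>C x)" for x
    by (simp add: V_def J blinfun.diff_left blinfun.scaleR_left)
  have ii: "\<i> *\<^sub>C \<i> *\<^sub>C x = - x" for x :: 'a
    using scaleC_of_real[of "-1" x] by (simp add: scaleC_scaleC)
  have WV: "blinfun_apply W (blinfun_apply V x) = blinfun_apply Q x" for x
    unfolding W V' Q by (simp add: blinfun.diff_right blinfun.scaleR_right Dc scaleC_diff_right
        scaleC_scaleR_commute ii power2_eq_square algebra_simps)
  have VW: "blinfun_apply V (blinfun_apply W x) = blinfun_apply Q x" for x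
    unfolding W V' Q by (simp add: blinfun.add_right blinfun.scaleR_right Dc scaleC_add_right
        scaleC_scaleR_commute ii power2_eq_square algebra_simps)
  have Sc: "clinear_op (S o\<^sub>L W)"
    unfolding W_def using S Dsa Jc
    by (intro clinear_op_compose clinear_op_add clinear_op_scaleR)
      (auto simp: is_op_inverse_def selfadjoint_def)
  have left: "blinfun_apply (S o\<^sub>L W) (blinfun_apply V x) = x" for x
    by (simp add: WV SQ)
  \<comment> \<open>\<open>S o\<^sub>L W\<close> is a left inverse of \<open>V\<close> and
    \<open>W o\<^sub>L S\<close> is a right inverse, so they agree.\<close>
  have "blinfun_apply (S o\<^sub>L W) x = blinfun_apply W (blinfun_apply S x)" for x
    by (metis left VW QS)
  then have "blinfun_apply V (blinfun_apply (S o\<^sub>L W) x) = x" for x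
    using VW QS by simp
  with left Sc show ?thesis
    unfolding spectrum_def V by blast
qed

text \<open>Two uses of the preceding criterion: the constant \<open>(Im z)\<^sup>2\<close> excludes
  nonreal \<open>z\<close>, and a lower bound for \<open>A - t\<close> excludes a real
  \<open>t\<close>. Only approximate eigenvalues remain.\<close>

lemma spectrum_selfadjoint_cases:
  assumes A: "selfadjoint A" and z: "z \<in> spectrum A"
  obtains t where "z = complex_of_real t"
    and "\<And>m. m > 0 \<Longrightarrow> \<exists>x. norm (blinfun_apply A x - t *\<^sub>R x) < m * norm x"
proof -
  have "Im z = 0"
  proof (rule ccontr)
    assume "Im z \<noteq> 0"
    then have "z \<notin> spectrum A"
      by (intro not_in_spectrum_of_square[OF A, of "(Im z)\<^sup>2"]) auto
    then show False using z by simp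
  qed
  then have zr: "z = complex_of_real (Re z)" by (simp add: complex_eq_iff)
  moreover have "\<exists>x. norm (blinfun_apply A x - Re z *\<^sub>R x) < m * norm x" if m: "m > 0" for m
  proof (rule ccontr)
    assume "\<not> ?thesis"
    then have *: "m * norm x \<le> norm (blinfun_apply A x - Re z *\<^sub>R x)" for x
      by (meson not_less)
    have "z \<notin> spectrum A"
    proof (rule not_in_spectrum_of_square[OF A, of "m\<^sup>2"])
      fix x
      have "(m * norm x)\<^sup>2 \<le> (norm (blinfun_apply A x - Re z *\<^sub>R x))\<^sup>2"
        using * m by (intro power_mono) auto
      then show "m\<^sup>2 * (norm x)\<^sup>2 \<le>
          (norm (blinfun_apply A x - Re z *\<^sub>R x))\<^sup>2 + (Im z)\<^sup>2 * (norm x)\<^sup>2"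
        by (simp add: power_mult_distrib add_increasing2)
    qed (use m in simp)
    then show False using z by simp
  qed
  ultimately show thesis by (rule that)
qed

lemma bounded_below_off_spectrum:
  assumes "complex_of_real t \<notin> spectrum A"
  obtains m where "m > 0" "\<And>x. m * norm x \<le> norm (blinfun_apply A x - t *\<^sub>R x)"
proof -
  obtain S where S: "blinfun_apply S (blinfun_apply A x - t *\<^sub>R x) = x" for x
  proof -
    have "\<exists>S. \<forall>x. blinfun_apply S (blinfun_apply A x - t *\<^sub>R x) = x"
      using assms by (auto simp: spectrum_def scaleC_of_real)
    then show thesis using that by blast
  qed
  \<comment> \<open>Adding 1 makes the factor positive and hence invertible, also for
    \<open>S = 0\<close>.\<close>
  have "norm x \<le> (norm S + 1) * norm (blinfun_apply A x - t *\<^sub>R x)" for x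
    using norm_blinfun[of S "blinfun_apply A x - t *\<^sub>R x"] by (simp add: S distrib_right add_increasing2)
  then have "inverse (norm S + 1) * norm x \<le> norm (blinfun_apply A x - t *\<^sub>R x)" for x
    by (simp add: field_simps add_pos_nonneg pos_divide_le_eq)
  then show thesis
    by (intro that[of "inverse (norm S + 1)"]) (auto simp: add_nonneg_pos)
qed

text \<open>\<open>A - t\<close> differs from the scalar \<open>c - t\<close> by at most
  \<open>r\<close> in norm. If \<open>\<bar>t - c\<bar>\<close> exceeded \<open>r\<close>, it would
  be bounded below by the difference, and \<open>t\<close> could not be an approximate
  eigenvalue.\<close>

lemma spectrum_subset_interval:
  assumes A: "selfadjoint A" and r: "norm (A - c *\<^sub>R id_blinfun) \<le> r"
  shows "spectrum A \<subseteq> complex_of_real ` {c - r..c + r}"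
proof
  fix z assume "z \<in> spectrum A"
  then obtain t where t: "z = complex_of_real t"
    "\<And>m. m > 0 \<Longrightarrow> \<exists>x. norm (blinfun_apply A x - t *\<^sub>R x) < m * norm x"
    using spectrum_selfadjoint_cases[OF A] by metis
  have "\<bar>t - c\<bar> \<le> r"
  proof (rule ccontr)
    assume "\<not> \<bar>t - c\<bar> \<le> r"
    then obtain x where x: "norm (blinfun_apply A x - t *\<^sub>R x) < (\<bar>t - c\<bar> - r) * norm x"
      using t(2)[of "\<bar>t - c\<bar> - r"] by auto
    have "norm ((t - c) *\<^sub>R x) \<le> norm (blinfun_apply (A - c *\<^sub>R id_blinfun) x)
        + norm (blinfun_apply A x - t *\<^sub>R x)"
    proof -
      have "(t - c) *\<^sub>R x = blinfun_apply (A - c *\<^sub>R id_blinfun) x - (blinfun_apply A x - t *\<^sub>R x)"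
        by (simp add: blinfun.diff_left blinfun.scaleR_left algebra_simps)
      then show ?thesis by (metis norm_triangle_ineq4)
    qed
    also have "\<dots> < r * norm x + (\<bar>t - c\<bar> - r) * norm x"
    proof -
      have "norm (A - c *\<^sub>R id_blinfun) * norm x \<le> r * norm x"
        using r by (intro mult_right_mono) auto
      then show ?thesis
        using norm_blinfun[of "A - c *\<^sub>R id_blinfun" x] x by linarith
    qed
    finally show False by (simp add: left_diff_distrib)
  qed
  then show "z \<in> complex_of_real ` {c - r..c + r}"
    using t(1) by (auto simp: abs_le_iff)
qed

text \<open>Makes the space of bounded operators complete, so that Cauchy sequences of polynomials
  of an operator converge in norm.\<close>

instance complex_hilbert \<subseteq> banach ..

section \<open>Continuous functional calculus\<close>

lemma op_poly_0 [simp]: "op_poly 0 A = 0"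
  by (simp add: op_poly_def)

text \<open>Horner's rule replaces the power sum of the definition by a recursion, so that the
  algebraic laws of \<open>op_poly\<close> follow by induction on the polynomial.\<close>

lemma op_poly_pCons [simp]: "op_poly (pCons a p) A = a *\<^sub>R id_blinfun + (A o\<^sub>L op_poly p A)"
proof (cases "p = 0")
  case True
  then show ?thesis by (cases "a = 0") (simp_all add: op_poly_def)
next
  case False
  have "op_poly (pCons a p) A
      = a *\<^sub>R id_blinfun + (\<Sum>i\<le>degree p. coeff p i *\<^sub>R (A o\<^sub>L (((o\<^sub>L) A) ^^ i) id_blinfun))"
    using False by (simp add: op_poly_def sum.atMost_Suc_shift del: sum.atMost_Suc)
  also have "(\<Sum>i\<le>degree p. coeff p i *\<^sub>R (A o\<^sub>L (((o\<^sub>L) A) ^^ i) id_blinfun)) = (A o\<^sub>L op_poly p A)"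
    by (simp add: op_poly_def bounded_bilinear.sum_right[OF bounded_bilinear_blinfun_compose]
        bounded_bilinear.scaleR_right[OF bounded_bilinear_blinfun_compose])
  finally show ?thesis .
qed

lemma op_poly_add: "op_poly (p + q) A = op_poly p A + op_poly q A"
proof (induction p arbitrary: q)
  case IH: (pCons a p)
  show ?case
  proof (cases q)
    case (pCons b r)
    then show ?thesis
      by (intro blinfun_eqI) (simp add: IH.IH blinfun.bilinear_simps scaleR_add_left)
  qed
qed simp

lemma op_poly_smult: "op_poly (smult c p) A = c *\<^sub>R op_poly p A"
  by (induction p) (auto intro!: blinfun_eqI simp: blinfun.bilinear_simps algebra_simps)

lemma op_poly_diff: "op_poly (p - q) A = op_poly p A - op_poly q A"
proof -
  have "op_poly (p + smult (-1) q) A = op_poly p A + (-1) *\<^sub>R op_poly q A"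
    by (simp only: op_poly_add op_poly_smult)
  then show ?thesis by simp
qed

lemma op_poly_mult: "op_poly (p * q) A = (op_poly p A o\<^sub>L op_poly q A)"
  by (induction p)
    (auto intro!: blinfun_eqI simp: op_poly_add op_poly_smult blinfun.bilinear_simps)

lemma op_poly_commute: "(A o\<^sub>L op_poly p A) = (op_poly p A o\<^sub>L A)"
proof (induction p)
  case (pCons a p)
  have "blinfun_apply A (blinfun_apply (op_poly p A) x) = blinfun_apply (op_poly p A) (blinfun_apply A x)" for x
    using arg_cong[OF \<open>(A o\<^sub>L op_poly p A) = (op_poly p A o\<^sub>L A)\<close>, of "\<lambda>B. blinfun_apply B x"] by simp
  then show ?case
    by (intro blinfun_eqI) (simp add: blinfun.bilinear_simps)
qed simp

lemma selfadjoint_op_poly: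
  assumes "selfadjoint A"
  shows "selfadjoint (op_poly p A)"
proof (induction p)
  case (pCons a p)
  then show ?case
    using assms by (auto intro!: selfadjoint_add selfadjoint_scaleR selfadjoint_compose op_poly_commute)
qed simp

section \<open>The norm of a polynomial of a self-adjoint operator\<close>

lemma real_poly_factor:
  fixes p :: "real poly"
  assumes "degree p > 0"
  obtains (linear) t q where "p = [:- t, 1:] * q"
    | (quadratic) u v q where "v \<noteq> 0" "p = [:u\<^sup>2 + v\<^sup>2, - 2 * u, 1:] * q"
proof -
  let ?P = "map_poly complex_of_real p"
  have "degree ?P = degree p" by (simp add: degree_map_poly)
  then have "\<not> constant (poly ?P)"
    using assms by (simp add: constant_degree)
  then obtain z where z: "poly ?P z = 0"
    using fundamental_theorem_of_algebra by blast
  have poly_hom: "poly (map_poly complex_of_real p) (complex_of_real x) = complex_of_real (poly p x)" for p x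
    by (induction p) (simp_all add: map_poly_pCons)
  show thesis
  proof (cases "Im z = 0")
    case True
    then have "z = complex_of_real (Re z)" by (simp add: complex_eq_iff)
    then have "complex_of_real (poly p (Re z)) = 0"
      using z poly_hom by metis
    then have "[:- Re z, 1:] dvd p" by (simp add: poly_eq_0_iff_dvd)
    then show thesis using linear by (auto elim: dvdE)
  next
    case False
    \<comment> \<open>The real quadratic with roots \<open>z\<close> and
      \<open>cnj z\<close>.\<close>
    define d where "d = [:(Re z)\<^sup>2 + (Im z)\<^sup>2, - 2 * Re z, 1:]"
    have hom: "map_poly complex_of_real (a * b) = map_poly complex_of_real a * map_poly complex_of_real b"
       "map_poly complex_of_real (a + b) = map_poly complex_of_real a + map_poly complex_of_real b" for a b
      by (auto simp: poly_eq_iff coeff_map_poly coeff_mult)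
    define r where "r = p mod d"
    have "p = d * (p div d) + r" by (simp add: r_def)
    then have "?P = map_poly complex_of_real d * map_poly complex_of_real (p div d) + map_poly complex_of_real r"
      by (metis hom)
    moreover have "poly (map_poly complex_of_real d) z = 0"
      by (simp add: d_def map_poly_pCons complex_eq_iff power2_eq_square)
    ultimately have rz: "poly (map_poly complex_of_real r) z = 0"
      using z by simp
    have "d \<noteq> 0" "degree d = 2" by (auto simp: d_def)
    then have "r = 0 \<or> degree r < 2" unfolding r_def using degree_mod_less[of d p] by simp
    then have "degree r \<le> 1" by auto
    then have "r = [:coeff r 0, coeff r 1:]"
      by (intro poly_eqI) (auto simp: coeff_pCons coeff_eq_0 split: nat.split)
    then obtain a b where r: "r = [:a, b:]" by blast
    \<comment> \<open>A real polynomial of degree at most one that vanishes at a nonreal number is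
      zero.\<close>
    have "b * Im z = 0" "a + b * Re z = 0"
      using rz by (auto simp: r map_poly_pCons complex_eq_iff mult.commute)
    then have "r = 0" using False r by simp
    then show thesis
      using quadratic[OF False, of "Re z" "p div d"] \<open>p = d * (p div d) + r\<close> by (simp add: d_def)
  qed
qed

lemma op_poly_bounded_below:
  fixes A :: "'a::complex_hilbert \<Rightarrow>\<^sub>L 'a"
  assumes A: "selfadjoint A" and "p \<noteq> 0" and "\<And>t. t \<in> real_spectrum A \<Longrightarrow> poly p t \<noteq> 0"
  shows "\<exists>m>0. \<forall>x. m * norm x \<le> norm (blinfun_apply (op_poly p A) x)"
  using assms(2-)
proof (induction "degree p" arbitrary: p rule: less_induct)
  case less
  \<comment> \<open>Splitting off a factor that is bounded below lowers the degree, and lower bounds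
    multiply.\<close>
  have step: ?case
    if p: "p = d * q" and "degree d > 0" "m > 0"
      and d: "\<And>x. m * norm x \<le> norm (blinfun_apply (op_poly d A) x)" for d q m
  proof -
    have "q \<noteq> 0" "d \<noteq> 0" using p less.prems by auto
    then have "degree q < degree p" using that by (simp add: degree_mult_eq)
    moreover have "poly q t \<noteq> 0" if "t \<in> real_spectrum A" for t
      using less.prems(2)[OF that] p by auto
    ultimately obtain k where k: "k > 0" "\<And>x. k * norm x \<le> norm (blinfun_apply (op_poly q A) x)"
      using less.hyps \<open>q \<noteq> 0\<close> by blast
    have "m * k * norm x \<le> norm (blinfun_apply (op_poly p A) x)" for x
    proof -
      have "m * (k * norm x) \<le> m * norm (blinfun_apply (op_poly q A) x)"
        using k \<open>m > 0\<close> by (intro mult_left_mono) auto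
      also have "\<dots> \<le> norm (blinfun_apply (op_poly p A) x)"
        using d by (simp add: p op_poly_mult)
      finally show ?thesis by (simp add: mult.assoc)
    qed
    then show ?thesis using k \<open>m > 0\<close> by (intro exI[of _ "m * k"]) auto
  qed
  show ?case
  proof (cases "degree p = 0")
    case True
    then obtain a where "p = [:a:]" by (rule degree_eq_zeroE)
    moreover have "a \<noteq> 0" using less.prems \<open>p = [:a:]\<close> by simp
    ultimately show ?thesis
      by (intro exI[of _ "\<bar>a\<bar>"]) (simp add: blinfun.bilinear_simps)
  next
    case False
    then have "degree p > 0" by simp
    then show ?thesis
    proof (cases p rule: real_poly_factor)
      case (linear t q)
      then have "t \<notin> real_spectrum A" using less.prems(2)[of t] by auto
      then obtain m where "m > 0" "\<And>x. m * norm x \<le> norm (blinfun_apply A x - t *\<^sub>R x)"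
        using bounded_below_off_spectrum[of t A] unfolding real_spectrum_def by blast
      then show ?thesis
        by (intro step[OF linear, of m]) (simp_all add: blinfun.bilinear_simps)
    next
      case (quadratic u v q)
      let ?D = "A - u *\<^sub>R id_blinfun"
      have D: "selfadjoint ?D" by (intro selfadjoint_diff selfadjoint_scaleR selfadjoint_id A)
      \<comment> \<open>This quadratic of \<open>A\<close> is \<open>?D\<^sup>2 + v\<^sup>2\<close>,
        whose form is at least \<open>v\<^sup>2\<close>, whatever the spectrum of
        \<open>A\<close>.\<close>
      have "v\<^sup>2 * norm x \<le> norm (blinfun_apply (op_poly [:u\<^sup>2 + v\<^sup>2, - 2 * u, 1:] A) x)" for x
      proof (cases "x = 0")
        case False
        have "blinfun_apply (op_poly [:u\<^sup>2 + v\<^sup>2, - 2 * u, 1:] A) x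
            = blinfun_apply ?D (blinfun_apply ?D x) + v\<^sup>2 *\<^sub>R x" (is "?y = _")
          by (simp add: blinfun.bilinear_simps algebra_simps power2_eq_square
              flip: scaleR_add_left)
        then have "inner ?y x = inner (blinfun_apply ?D x) (blinfun_apply ?D x) + v\<^sup>2 * inner x x"
          using selfadjoint_inner[OF D, of "blinfun_apply ?D x" x] by (simp add: inner_add_left)
        then have "v\<^sup>2 * inner x x \<le> norm ?y * norm x"
          using norm_cauchy_schwarz[of ?y x] inner_ge_zero[of "blinfun_apply ?D x"] by linarith
        then have "(v\<^sup>2 * norm x) * norm x \<le> norm ?y * norm x"
          by (simp add: power2_norm_eq_inner[symmetric] power2_eq_square mult.assoc)
        then show ?thesis using False by simp
      qed simp
      then show ?thesis
        using quadratic(1) by (intro step[OF quadratic(2), of "v\<^sup>2"]) auto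
    qed
  qed
qed

text \<open>Expanding the square of the right-hand side of \<open>below\<close> and using
  \<open>norm (S (S x)) \<le> N * norm (S x)\<close> gives \<open>*\<close>. This inequality pushes
  the norm of \<open>S\<close> strictly below \<open>N\<close>, its own value, unless the space is
  trivial.\<close>

lemma norm_squared_not_bounded_below:
  fixes S :: "'a::complex_hilbert \<Rightarrow>\<^sub>L 'a"
  assumes S: "selfadjoint S" and m: "m > 0"
    and below: "\<And>x. m * norm x \<le> norm (blinfun_apply S (blinfun_apply S x) - (norm S)\<^sup>2 *\<^sub>R x)"
  shows "x = (0::'a)"
proof -
  define N where "N = norm S"
  have *: "m\<^sup>2 * (norm x)\<^sup>2 + N\<^sup>2 * (norm (blinfun_apply S x))\<^sup>2 \<le> (N\<^sup>2)\<^sup>2 * (norm x)\<^sup>2" for x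
  proof -
    let ?y = "blinfun_apply S x"
    have "(m * norm x)\<^sup>2 \<le> (norm (blinfun_apply S ?y - N\<^sup>2 *\<^sub>R x))\<^sup>2"
      using below[of x] m by (intro power_mono) (auto simp: N_def)
    also have "\<dots> = (norm (blinfun_apply S ?y))\<^sup>2 - 2 * N\<^sup>2 * (norm ?y)\<^sup>2 + (N\<^sup>2)\<^sup>2 * (norm x)\<^sup>2"
      unfolding power2_norm_eq_inner inner_diff_left inner_diff_right inner_scaleR_left
        inner_scaleR_right inner_commute[of x "blinfun_apply S ?y"] selfadjoint_inner[OF S, of ?y x]
      by (simp add: power2_eq_square right_diff_distrib mult.assoc)
    also have "(norm (blinfun_apply S ?y))\<^sup>2 \<le> (N * norm ?y)\<^sup>2"
      unfolding N_def by (intro power_mono norm_blinfun) simp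
    finally show ?thesis by (simp add: power_mult_distrib)
  qed
  have N0: "N \<ge> 0" by (simp add: N_def)
  show ?thesis
  proof (cases "N = 0")
    case True
    then have "m\<^sup>2 * (norm x)\<^sup>2 \<le> 0" using *[of x] by simp
    then show ?thesis using m by (simp add: mult_le_0_iff)
  next
    case False
    then have N: "N > 0" using N0 by simp
    show ?thesis
    proof (rule ccontr)
      assume x: "x \<noteq> 0"
      have sm: "m\<^sup>2 \<le> (N\<^sup>2)\<^sup>2"
      proof -
        have "m\<^sup>2 * (norm x)\<^sup>2 \<le> (N\<^sup>2)\<^sup>2 * (norm x)\<^sup>2"
          using *[of x] by (smt (verit) zero_le_mult_iff zero_le_power2)
        then show ?thesis using x by simp
      qed
      \<comment> \<open>The bound on \<open>norm S\<close> that results from dividing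
        \<open>*\<close> by \<open>N\<^sup>2\<close>.\<close>
      define K where "K = sqrt (N\<^sup>2 - m\<^sup>2 / N\<^sup>2)"
      have arg: "0 \<le> N\<^sup>2 - m\<^sup>2 / N\<^sup>2" using sm N by (simp add: field_simps power2_eq_square)
      have "norm S \<le> K"
      proof (rule norm_blinfun_bound)
        show "0 \<le> K" using arg by (simp add: K_def)
        fix x
        have "(norm (blinfun_apply S x))\<^sup>2 \<le> (N\<^sup>2 - m\<^sup>2 / N\<^sup>2) * (norm x)\<^sup>2"
          using *[of x] N by (simp add: field_simps power2_eq_square)
        also have "\<dots> = (K * norm x)\<^sup>2" using arg by (simp add: K_def power_mult_distrib)
        finally show "norm (blinfun_apply S x) \<le> K * norm x"
          by (rule power2_le_imp_le) (use arg in \<open>simp add: K_def\<close>)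
      qed
      moreover have "K < N"
        unfolding K_def using m N by (intro real_less_lsqrt) auto
      ultimately show False by (simp add: N_def)
    qed
  qed
qed

text \<open>The assumption on \<open>p\<close> makes \<open>p\<^sup>2 - N\<^sup>2\<close>, with
  \<open>N\<close> the norm of \<open>p(A)\<close>, a nonzero polynomial. Not being bounded below at
  \<open>A\<close>, it has a root in the spectrum.\<close>

lemma norm_op_poly_in_spectrum:
  fixes A :: "'a::complex_hilbert \<Rightarrow>\<^sub>L 'a"
  assumes A: "selfadjoint A" and x: "(x::'a) \<noteq> 0" and p: "p\<^sup>2 \<noteq> [:(norm (op_poly p A))\<^sup>2:]"
  obtains t where "t \<in> real_spectrum A" "\<bar>poly p t\<bar> = norm (op_poly p A)"
proof -
  let ?q = "p * p - [:(norm (op_poly p A))\<^sup>2:]"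
  have "?q \<noteq> 0" using p by (simp add: power2_eq_square)
  moreover have "\<not> (\<exists>m>0. \<forall>x. m * norm x \<le> norm (blinfun_apply (op_poly ?q A) x))"
    using norm_squared_not_bounded_below[OF selfadjoint_op_poly[OF A, of p]] x
    by (auto simp: op_poly_diff op_poly_mult blinfun.bilinear_simps)
  ultimately obtain t where t: "t \<in> real_spectrum A" "poly ?q t = 0"
    using op_poly_bounded_below[OF A] by blast
  then have "\<bar>poly p t\<bar>\<^sup>2 = (norm (op_poly p A))\<^sup>2" by (simp add: power2_eq_square)
  then have "\<bar>poly p t\<bar> = norm (op_poly p A)" by (simp only: power2_eq_iff_nonneg abs_ge_zero norm_ge_zero)
  then show thesis using t that by blast
qed

lemma norm_op_poly_le:
  fixes A :: "'a::complex_hilbert \<Rightarrow>\<^sub>L 'a"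
  assumes A: "selfadjoint A" and M: "0 \<le> M" "\<And>t. t \<in> real_spectrum A \<Longrightarrow> \<bar>poly p t\<bar> \<le> M"
  shows "norm (op_poly p A) \<le> M"
proof (cases "\<exists>x::'a. x \<noteq> 0")
  case True
  then obtain x :: 'a where x: "x \<noteq> 0" by blast
  show ?thesis
  proof (cases "p\<^sup>2 = [:(norm (op_poly p A))\<^sup>2:]")
    case False
    then show ?thesis using norm_op_poly_in_spectrum[OF A x] M by metis
  next
    case True
    \<comment> \<open>Here \<open>p\<close> is constant, and the bound on the spectrum says
      something only if the spectrum is nonempty. The polynomial of \<open>A\<close> itself provides
      a point of it.\<close>
    have "([:0, 1:]::real poly)\<^sup>2 \<noteq> [:(norm (op_poly [:0, 1:] A))\<^sup>2:]"
      by (simp add: power2_eq_square)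
    then obtain t where t: "t \<in> real_spectrum A"
      using norm_op_poly_in_spectrum[OF A x] by blast
    have "(poly p t)\<^sup>2 = (norm (op_poly p A))\<^sup>2" using arg_cong[OF True, of "\<lambda>p. poly p t"] by simp
    then have "\<bar>poly p t\<bar> = norm (op_poly p A)" by (metis abs_norm_cancel power2_eq_iff_nonneg abs_ge_zero norm_ge_zero power2_abs)
    then show ?thesis using M(2)[OF t] by simp
  qed
next
  case False
  then have "op_poly p A = 0" by (intro blinfun_eqI) auto
  then show ?thesis using M by simp
qed

section \<open>Limits of polynomials that converge uniformly on the spectrum\<close>

definition fc_limit :: "(real \<Rightarrow> real) \<Rightarrow> ('a::complex_hilbert \<Rightarrow>\<^sub>L 'a) \<Rightarrow> ('a \<Rightarrow>\<^sub>L 'a) \<Rightarrow> bool" where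
  "fc_limit f A B \<longleftrightarrow> (\<exists>P. uniform_limit (real_spectrum A) (\<lambda>n. poly (P n)) f sequentially \<and>
     (\<lambda>n. op_poly (P n) A) \<longlonglongrightarrow> B)"

text \<open>The right-hand side is the property under the \<open>THE\<close> of
  \<open>fun_calc\<close>. The sequential form on the left gives access to the limit laws for sums
  and products.\<close>

lemma fc_limit_iff:
  "fc_limit f A B \<longleftrightarrow> (\<forall>e>0. \<exists>p.
     (\<forall>t. complex_of_real t \<in> spectrum A \<longrightarrow> \<bar>poly p t - f t\<bar> \<le> e) \<and> norm (op_poly p A - B) \<le> e)"
proof
  assume "fc_limit f A B"
  then obtain P where P: "uniform_limit (real_spectrum A) (\<lambda>n. poly (P n)) f sequentially"
    "(\<lambda>n. op_poly (P n) A) \<longlonglongrightarrow> B" by (auto simp: fc_limit_def)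
  show "\<forall>e>0. \<exists>p. (\<forall>t. complex_of_real t \<in> spectrum A \<longrightarrow> \<bar>poly p t - f t\<bar> \<le> e) \<and> norm (op_poly p A - B) \<le> e"
  proof (intro allI impI)
    fix e :: real assume e: "e > 0"
    have "\<forall>\<^sub>F n in sequentially. (\<forall>t\<in>real_spectrum A. dist (poly (P n) t) (f t) < e) \<and> dist (op_poly (P n) A) B < e"
      using uniform_limitD[OF P(1) e] tendstoD[OF P(2) e] by (rule eventually_conj)
    then obtain n where n: "(\<forall>t\<in>real_spectrum A. dist (poly (P n) t) (f t) < e) \<and> dist (op_poly (P n) A) B < e"
      using eventually_happens trivial_limit_sequentially by blast
    show "\<exists>p. (\<forall>t. complex_of_real t \<in> spectrum A \<longrightarrow> \<bar>poly p t - f t\<bar> \<le> e) \<and> norm (op_poly p A - B) \<le> e"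
      using n by (intro exI[of _ "P n"]) (auto simp: real_spectrum_def dist_norm less_imp_le)
  qed
next
  assume *: "\<forall>e>0. \<exists>p. (\<forall>t. complex_of_real t \<in> spectrum A \<longrightarrow> \<bar>poly p t - f t\<bar> \<le> e) \<and> norm (op_poly p A - B) \<le> e"
  then have "\<forall>n. \<exists>p. (\<forall>t\<in>real_spectrum A. \<bar>poly p t - f t\<bar> \<le> inverse (real (Suc n)))
      \<and> norm (op_poly p A - B) \<le> inverse (real (Suc n))"
    by (simp add: real_spectrum_def)
  then obtain P where P: "\<And>n t. t \<in> real_spectrum A \<Longrightarrow> \<bar>poly (P n) t - f t\<bar> \<le> inverse (real (Suc n))"
      "\<And>n. norm (op_poly (P n) A - B) \<le> inverse (real (Suc n))"
    by metis
  have "uniform_limit (real_spectrum A) (\<lambda>n. poly (P n)) f sequentially"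
  proof (rule uniform_limitI)
    fix e :: real assume "e > 0"
    then have "\<forall>\<^sub>F n in sequentially. inverse (real (Suc n)) < e"
      using LIMSEQ_inverse_real_of_nat by (auto dest: order_tendstoD)
    then show "\<forall>\<^sub>F n in sequentially. \<forall>t\<in>real_spectrum A. dist (poly (P n) t) (f t) < e"
      by eventually_elim (unfold dist_norm real_norm_def, blast intro: le_less_trans P(1))
  qed
  moreover have "(\<lambda>n. op_poly (P n) A) \<longlonglongrightarrow> B"
  proof (rule Lim_transform_bound[THEN LIM_zero_cancel])
    show "\<forall>\<^sub>F n in sequentially. norm (op_poly (P n) A - B) \<le> norm (inverse (real (Suc n)))"
      using P(2) by (simp del: of_nat_Suc)
    show "(\<lambda>n. inverse (real (Suc n))) \<longlonglongrightarrow> 0" by (rule LIMSEQ_inverse_real_of_nat)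
  qed
  ultimately show "fc_limit f A B" by (auto simp: fc_limit_def)
qed

text \<open>Inherited from polynomials up to an arbitrary error. Applied to the zero function with
  \<open>M = 0\<close> it gives uniqueness of the limit; with \<open>M\<close> half the range of a
  nonnegative function it gives positivity.\<close>

lemma fc_limit_norm_le:
  assumes A: "selfadjoint A" and fc: "fc_limit f A B"
    and M: "0 \<le> M" "\<And>t. t \<in> real_spectrum A \<Longrightarrow> \<bar>f t\<bar> \<le> M"
  shows "norm B \<le> M"
proof (rule field_le_epsilon)
  fix e :: real assume e: "e > 0"
  then obtain p where p: "\<And>t. t \<in> real_spectrum A \<Longrightarrow> \<bar>poly p t - f t\<bar> \<le> e / 2" "norm (op_poly p A - B) \<le> e / 2"
    using fc unfolding fc_limit_iff real_spectrum_def by (metis half_gt_zero mem_Collect_eq)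
  have "\<bar>poly p t\<bar> \<le> M + e / 2" if "t \<in> real_spectrum A" for t
    using p(1)[OF that] M(2)[OF that] by linarith
  then have "norm (op_poly p A) \<le> M + e / 2"
    using M(1) e by (intro norm_op_poly_le[OF A]) auto
  then show "norm B \<le> M + e"
    using p(2) norm_triangle_ineq4[of "op_poly p A" "op_poly p A - B"] by simp
qed

lemma fc_limit_poly: "fc_limit (poly p) A (op_poly p A)"
  unfolding fc_limit_def by (intro exI[of _ "\<lambda>_. p"]) (simp add: uniform_limit_const)

lemma fc_limit_cong:
  assumes "\<And>t. t \<in> real_spectrum A \<Longrightarrow> f t = g t"
  shows "fc_limit f A B \<longleftrightarrow> fc_limit g A B"
  using assms unfolding fc_limit_iff real_spectrum_def by simp

lemma fc_limit_diff:
  assumes "fc_limit f A B" "fc_limit g A C"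
  shows "fc_limit (\<lambda>t. f t - g t) A (B - C)"
proof -
  obtain P Q where "uniform_limit (real_spectrum A) (\<lambda>n. poly (P n)) f sequentially"
    "(\<lambda>n. op_poly (P n) A) \<longlonglongrightarrow> B"
    "uniform_limit (real_spectrum A) (\<lambda>n. poly (Q n)) g sequentially"
    "(\<lambda>n. op_poly (Q n) A) \<longlonglongrightarrow> C" using assms by (auto simp: fc_limit_def)
  then show ?thesis unfolding fc_limit_def
    by (intro exI[of _ "\<lambda>n. P n - Q n"])
      (auto simp: op_poly_diff poly_diff[abs_def] intro!: uniform_limit_minus tendsto_diff)
qed

lemma fc_limit_unique:
  assumes "selfadjoint A" "fc_limit f A B" "fc_limit f A C"
  shows "B = C"
  using fc_limit_norm_le[OF assms(1) fc_limit_diff[OF assms(2,3)], of 0] by simp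

lemma fun_calc_eq:
  assumes "selfadjoint A" "fc_limit f A B"
  shows "fun_calc f A = B"
  unfolding fun_calc_def fc_limit_iff[symmetric]
  using assms fc_limit_unique by (blast intro: the_equality)

lemma real_spectrum_norm_bound:
  assumes "selfadjoint A" "t \<in> real_spectrum A"
  shows "\<bar>t\<bar> \<le> norm A"
  using spectrum_subset_interval[of A 0 "norm A"] assms
  by (auto simp: real_spectrum_def abs_le_iff)

text \<open>Within distance 1 of \<open>f\<close> on the spectrum there is a polynomial, bounded on
  \<open>{- norm A..norm A}\<close>. Continuity of \<open>f\<close> is not assumed; boundedness is
  what products of uniform limits require.\<close>

lemma fc_limit_bounded:
  assumes A: "selfadjoint A" and fc: "fc_limit f A B"
  obtains M where "M \<ge> 0" "\<And>t. t \<in> real_spectrum A \<Longrightarrow> \<bar>f t\<bar> \<le> M"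
proof -
  obtain p where p: "\<And>t. t \<in> real_spectrum A \<Longrightarrow> \<bar>poly p t - f t\<bar> \<le> 1"
    using fc unfolding fc_limit_iff real_spectrum_def by (metis zero_less_one mem_Collect_eq)
  have "compact (poly p ` {- norm A..norm A})"
    by (intro compact_continuous_image continuous_intros compact_Icc)
  then obtain K where K: "\<And>t. t \<in> {- norm A..norm A} \<Longrightarrow> norm (poly p t) \<le> K"
    by (meson bounded_iff compact_imp_bounded imageI)
  have b: "\<bar>f t\<bar> \<le> \<bar>K\<bar> + 1" if "t \<in> real_spectrum A" for t
    using K[of t] p[OF that] real_spectrum_norm_bound[OF A that]
    by (simp add: abs_le_iff)
  show thesis by (rule that[of "\<bar>K\<bar> + 1"]) (use b in auto)
qed

lemma fc_limit_mult:
  assumes A: "selfadjoint A" and f: "fc_limit f A B" and g: "fc_limit g A C"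
  shows "fc_limit (\<lambda>t. f t * g t) A (B o\<^sub>L C)"
proof -
  obtain P Q where P: "uniform_limit (real_spectrum A) (\<lambda>n. poly (P n)) f sequentially"
    "(\<lambda>n. op_poly (P n) A) \<longlonglongrightarrow> B" and
    Q: "uniform_limit (real_spectrum A) (\<lambda>n. poly (Q n)) g sequentially"
    "(\<lambda>n. op_poly (Q n) A) \<longlonglongrightarrow> C" using f g by (auto simp: fc_limit_def)
  have bdd: "bounded (h ` real_spectrum A)" if h: "fc_limit h A D" for h D
  proof -
    obtain M where "\<And>t. t \<in> real_spectrum A \<Longrightarrow> \<bar>h t\<bar> \<le> M"
      using fc_limit_bounded[OF A h] by blast
    then show ?thesis by (intro boundedI[of _ M]) auto
  qed
  have "uniform_limit (real_spectrum A) (\<lambda>n t. poly (P n) t * poly (Q n) t) (\<lambda>t. f t * g t) sequentially"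
    by (intro uniform_lim_mult P Q bdd[OF f] bdd[OF g])
  moreover have "(\<lambda>n. (op_poly (P n) A o\<^sub>L op_poly (Q n) A)) \<longlonglongrightarrow> (B o\<^sub>L C)"
    by (intro bounded_bilinear.tendsto[OF bounded_bilinear_blinfun_compose] P Q)
  ultimately show ?thesis
    unfolding fc_limit_def by (intro exI[of _ "\<lambda>n. P n * Q n"]) (simp add: op_poly_mult poly_mult[abs_def])
qed

lemma fc_limit_selfadjoint:
  assumes "selfadjoint A" "fc_limit f A B"
  shows "selfadjoint B"
proof -
  obtain P where "(\<lambda>n. op_poly (P n) A) \<longlonglongrightarrow> B" using assms(2) by (auto simp: fc_limit_def)
  then show ?thesis by (rule selfadjoint_limit[rotated]) (rule selfadjoint_op_poly[OF assms(1)])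
qed

text \<open>No square root of \<open>f\<close> is taken: \<open>0 \<le> f \<le> M\<close> means that
  \<open>f\<close> is within \<open>M / 2\<close> of the constant \<open>M / 2\<close>. Hence
  \<open>B\<close> is within \<open>M / 2\<close> of that multiple of the identity, and its form
  cannot be negative.\<close>

lemma fc_limit_nonneg:
  assumes A: "selfadjoint A" and fc: "fc_limit f A B"
    and nn: "\<And>t. t \<in> real_spectrum A \<Longrightarrow> 0 \<le> f t"
  shows "pos_semidef B"
  unfolding pos_semidef_iff
proof (intro conjI allI)
  show "selfadjoint B" using A fc by (rule fc_limit_selfadjoint)
  obtain M where M: "M \<ge> 0" "\<And>t. t \<in> real_spectrum A \<Longrightarrow> \<bar>f t\<bar> \<le> M"
    using fc_limit_bounded[OF A fc] by blast
  have "\<bar>f t - poly [:M / 2:] t\<bar> \<le> M / 2" if "t \<in> real_spectrum A" for t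
    using M(2)[OF that] nn[OF that] by (simp add: abs_le_iff field_simps)
  then have "norm (B - op_poly [:M / 2:] A) \<le> M / 2"
    using M(1) by (intro fc_limit_norm_le[OF A fc_limit_diff[OF fc fc_limit_poly]]) auto
  then have n: "norm (B - (M / 2) *\<^sub>R id_blinfun) \<le> M / 2" by simp
  fix x
  have "- inner (blinfun_apply (B - (M / 2) *\<^sub>R id_blinfun) x) x
      \<le> norm (blinfun_apply (B - (M / 2) *\<^sub>R id_blinfun) x) * norm x"
    using norm_cauchy_schwarz[of "- blinfun_apply (B - (M / 2) *\<^sub>R id_blinfun) x" x] by simp
  also have "\<dots> \<le> (M / 2 * norm x) * norm x"
    by (intro mult_right_mono order_trans[OF norm_blinfun] n) auto
  finally show "0 \<le> inner (blinfun_apply B x) x"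
    by (simp add: blinfun.bilinear_simps inner_diff_left power2_norm_eq_inner[symmetric] power2_eq_square)
qed

lemma fc_limit_ex:
  assumes A: "selfadjoint A" and ab: "real_spectrum A \<subseteq> {a..b}" and f: "continuous_on {a..b} f"
  obtains B where "fc_limit f A B"
proof -
  have "\<exists>p. \<forall>t\<in>{a..b}. \<bar>poly p t - f t\<bar> < inverse (real (Suc n))" for n
  proof -
    have pos: "inverse (real (Suc n)) > 0" by simp
    obtain g where g: "real_polynomial_function g" "\<And>t. t \<in> {a..b} \<Longrightarrow> \<bar>f t - g t\<bar> < inverse (real (Suc n))"
      by (rule Stone_Weierstrass_real_polynomial_function[OF compact_Icc f pos]) (rule that)
    then obtain c k where gk: "g = (\<lambda>x. \<Sum>i\<le>k. c i * x ^ i)"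
      using real_polynomial_function_iff_sum by auto
    have "poly (\<Sum>i\<le>k. monom (c i) i) t = g t" for t
      by (simp add: gk poly_sum poly_monom)
    then show ?thesis
      using g(2) by (intro exI[of _ "\<Sum>i\<le>k. monom (c i) i"]) (simp add: abs_minus_commute)
  qed
  then obtain P where P: "\<And>n t. t \<in> {a..b} \<Longrightarrow> \<bar>poly (P n) t - f t\<bar> < inverse (real (Suc n))"
    by metis
  have "uniform_limit {a..b} (\<lambda>n. poly (P n)) f sequentially"
  proof (rule uniform_limitI)
    fix e :: real assume "e > 0"
    then have "\<forall>\<^sub>F n in sequentially. inverse (real (Suc n)) < e"
      using LIMSEQ_inverse_real_of_nat by (auto dest: order_tendstoD)
    then show "\<forall>\<^sub>F n in sequentially. \<forall>t\<in>{a..b}. dist (poly (P n) t) (f t) < e"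
      by eventually_elim (unfold dist_norm real_norm_def, blast intro: less_trans P)
  qed
  then have unif: "uniform_limit (real_spectrum A) (\<lambda>n. poly (P n)) f sequentially"
    using ab by (rule uniform_limit_on_subset)
  have "Cauchy (\<lambda>n. op_poly (P n) A)"
  proof (rule metric_CauchyI)
    fix e :: real assume e: "e > 0"
    have "\<forall>\<^sub>F n in sequentially. \<forall>t\<in>real_spectrum A. dist (poly (P n) t) (f t) < e / 4"
      using e by (intro uniform_limitD[OF unif]) simp
    then obtain N where N: "\<And>n t. n \<ge> N \<Longrightarrow> t \<in> real_spectrum A \<Longrightarrow> \<bar>poly (P n) t - f t\<bar> < e / 4"
      unfolding eventually_sequentially dist_norm real_norm_def by blast
    show "\<exists>N. \<forall>m\<ge>N. \<forall>n\<ge>N. dist (op_poly (P m) A) (op_poly (P n) A) < e"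
    proof (intro exI[of _ N] allI impI)
      fix m n assume mn: "m \<ge> N" "n \<ge> N"
      \<comment> \<open>Closeness on the spectrum becomes closeness in norm.\<close>
      have "norm (op_poly (P m - P n) A) \<le> e / 2"
      proof (rule norm_op_poly_le[OF A])
        fix t assume t: "t \<in> real_spectrum A"
        show "\<bar>poly (P m - P n) t\<bar> \<le> e / 2"
          using N[OF mn(1) t] N[OF mn(2) t] unfolding poly_diff by linarith
      qed (use e in simp)
      then show "dist (op_poly (P m) A) (op_poly (P n) A) < e"
        using e by (simp add: dist_norm op_poly_diff)
    qed
  qed
  then obtain B where "(\<lambda>n. op_poly (P n) A) \<longlonglongrightarrow> B"
    using Cauchy_convergent_iff convergent_def by metis
  then show thesis using unif that unfolding fc_limit_def by blast
qed

section \<open>Operators with two eigenvalues\<close>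

lemma cmod_cinner_le: "cmod (cinner x y) \<le> norm x * norm (y::'a::complex_inner)"
proof (cases "cinner x y = 0")
  case False
  let ?c = "cinner x y"
  \<comment> \<open>Multiplying \<open>x\<close> by \<open>cnj ?c\<close> rotates the inner product
    onto the real axis, where the real Cauchy-Schwarz inequality applies.\<close>
  have "(cmod ?c)\<^sup>2 = inner (cnj ?c *\<^sub>C x) y"
    by (simp add: inner_eq_Re_cinner cinner_scaleC_left cmod_power2) (simp add: power2_eq_square)
  also have "\<dots> \<le> cmod ?c * norm x * norm y"
    using norm_cauchy_schwarz[of "cnj ?c *\<^sub>C x" y] by (simp add: norm_scaleC)
  finally show ?thesis
    using False by (simp add: power2_eq_square mult.assoc)
qed simp

text \<open>For a unit vector \<open>u\<close>, the orthogonal projection onto its complex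
  line.\<close>

definition rank_one :: "'a::complex_inner \<Rightarrow> 'a \<Rightarrow>\<^sub>L 'a" where
  "rank_one u = Blinfun (\<lambda>v. cinner v u *\<^sub>C u)"

lemma rank_one_apply: "blinfun_apply (rank_one u) v = cinner v u *\<^sub>C u"
proof -
  have "bounded_linear (\<lambda>v. cinner v u *\<^sub>C u)"
  proof (rule bounded_linear_intro[where K = "norm u * norm u"])
    show "cinner (r *\<^sub>R v) u *\<^sub>C u = r *\<^sub>R (cinner v u *\<^sub>C u)" for r v
      by (simp add: cinner_scaleC_left scaleC_scaleC flip: scaleC_of_real)
    show "norm (cinner v u *\<^sub>C u) \<le> norm v * (norm u * norm u)" for v
      using mult_right_mono[OF cmod_cinner_le[of v u], of "norm u"]
      by (simp add: norm_scaleC mult.assoc)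
  qed (simp add: cinner_add_left scaleC_add_left)
  then show ?thesis unfolding rank_one_def by (simp add: bounded_linear_Blinfun_apply)
qed

lemma selfadjoint_rank_one: "selfadjoint (rank_one (u::'a::complex_hilbert))"
  unfolding selfadjoint_def clinear_op_def rank_one_apply
  by (simp add: cinner_scaleC_left cinner_scaleC_right scaleC_scaleC cinner_commute[of u])

lemma inner_rank_one: "inner (blinfun_apply (rank_one u) v) v = (cmod (cinner v u))\<^sup>2"
proof -
  have "cinner v u * cinner u v = complex_of_real ((cmod (cinner v u))\<^sup>2)"
    unfolding complex_norm_square by (simp add: cinner_commute[of u])
  then show ?thesis
    unfolding rank_one_apply inner_eq_Re_cinner cinner_scaleC_left by (simp del: of_real_power)
qed

lemma cinner_self_unit: "norm u = 1 \<Longrightarrow> cinner u (u::'a::complex_inner) = 1"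
  using cinner_commute[of u u] inner_eq_Re_cinner[of u u]
  by (simp add: complex_eq_iff norm_eq_sqrt_inner)

lemma rank_one_idem:
  "norm (u::'a::complex_hilbert) = 1 \<Longrightarrow>
    blinfun_apply (rank_one u) (blinfun_apply (rank_one u) v) = blinfun_apply (rank_one u) v"
  by (simp add: rank_one_apply cinner_scaleC_left cinner_self_unit)

text \<open>For a unit vector \<open>u\<close>, the eigenvalue is \<open>y\<close> on the line of
  \<open>u\<close> and \<open>x\<close> on its orthogonal complement. Filling the complement with
  \<open>x\<close> keeps the spectrum within two points although \<open>ell2\<close> has infinite
  dimension.\<close>

definition two_eigen :: "real \<Rightarrow> real \<Rightarrow> 'a::complex_inner \<Rightarrow> 'a \<Rightarrow>\<^sub>L 'a" where
  "two_eigen x y u = x *\<^sub>R id_blinfun + (y - x) *\<^sub>R rank_one u"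

lemma two_eigen_apply: "blinfun_apply (two_eigen x y u) v = x *\<^sub>R v + (y - x) *\<^sub>R (cinner v u *\<^sub>C u)"
  by (simp add: two_eigen_def blinfun.bilinear_simps rank_one_apply)

lemma inner_two_eigen:
  "inner (blinfun_apply (two_eigen x y u) v) v = x * (norm v)\<^sup>2 + (y - x) * (cmod (cinner v u))\<^sup>2"
  by (simp add: two_eigen_apply inner_add_left inner_rank_one[unfolded rank_one_apply] power2_norm_eq_inner)

lemma selfadjoint_two_eigen: "selfadjoint (two_eigen x y (u::'a::complex_hilbert))"
  unfolding two_eigen_def
  by (intro selfadjoint_add selfadjoint_scaleR selfadjoint_id selfadjoint_rank_one)

text \<open>On an approximate eigenvector for \<open>t\<close>, \<open>p(A)\<close> acts nearly as
  the scalar \<open>poly p t\<close>, because \<open>p - poly p t\<close> is divisible by the linear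
  factor at \<open>t\<close>. If \<open>p(A) = 0\<close>, this scalar must vanish.\<close>

lemma spectrum_annihilated:
  assumes A: "selfadjoint A" and p: "op_poly p A = 0" and z: "z \<in> spectrum A"
  obtains t where "z = complex_of_real t" "poly p t = 0"
proof -
  obtain t where t: "z = complex_of_real t"
    "\<And>m. m > 0 \<Longrightarrow> \<exists>x. norm (blinfun_apply A x - t *\<^sub>R x) < m * norm x"
    using spectrum_selfadjoint_cases[OF A z] by metis
  have "poly p t = 0"
  proof (rule ccontr)
    assume nz: "poly p t \<noteq> 0"
    have "poly (p - [:poly p t:]) t = 0" by simp
    then obtain q where q: "p - [:poly p t:] = q * [:- t, 1:]"
      by (metis dvdE mult.commute poly_eq_0_iff_dvd)
    have b: "\<bar>poly p t\<bar> * norm x \<le> (norm (op_poly q A) + 1) * norm (blinfun_apply A x - t *\<^sub>R x)" for x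
    proof -
      have "op_poly (p - [:poly p t:]) A = op_poly q A o\<^sub>L op_poly [:- t, 1:] A"
        unfolding q by (rule op_poly_mult)
      then have "blinfun_apply (op_poly q A) (blinfun_apply A x - t *\<^sub>R x) = - poly p t *\<^sub>R x"
        by (auto simp: op_poly_diff p blinfun.bilinear_simps dest!: arg_cong[where f = "\<lambda>B. blinfun_apply B x"])
      then have "\<bar>poly p t\<bar> * norm x \<le> norm (op_poly q A) * norm (blinfun_apply A x - t *\<^sub>R x)"
        using norm_blinfun[of "op_poly q A" "blinfun_apply A x - t *\<^sub>R x"] by simp
      also have "\<dots> \<le> (norm (op_poly q A) + 1) * norm (blinfun_apply A x - t *\<^sub>R x)"
        by (intro mult_right_mono) auto
      finally show ?thesis .
    qed
    have N: "norm (op_poly q A) + 1 > 0" by (simp add: add_nonneg_pos)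
    obtain x where "norm (blinfun_apply A x - t *\<^sub>R x) < \<bar>poly p t\<bar> / (norm (op_poly q A) + 1) * norm x"
      using t(2)[of "\<bar>poly p t\<bar> / (norm (op_poly q A) + 1)"] nz N by auto
    then show False using b[of x] N by (simp add: field_simps)
  qed
  then show thesis using t(1) that by blast
qed

lemma two_eigen_spectrum:
  assumes u: "norm (u::'a::complex_hilbert) = 1"
  shows "spectrum (two_eigen x y u) \<subseteq> complex_of_real ` {x, y}"
proof
  fix z assume z: "z \<in> spectrum (two_eigen x y u)"
  have "op_poly ([:- x, 1:] * [:- y, 1:]) (two_eigen x y u) = 0"
    unfolding op_poly_mult
    by (rule blinfun_eqI) (simp add: two_eigen_def blinfun.bilinear_simps rank_one_idem[OF u] algebra_simps)
  then obtain t where "z = complex_of_real t" "poly ([:- x, 1:] * [:- y, 1:]) t = 0"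
    using spectrum_annihilated[OF selfadjoint_two_eigen _ z] by blast
  then have "z = complex_of_real t" "t = x \<or> t = y"
    unfolding poly_mult mult_eq_0_iff by auto
  then show "z \<in> complex_of_real ` {x, y}" by auto
qed

text \<open>Only the values of \<open>f\<close> at \<open>x\<close> and \<open>y\<close> matter, so
  a linear interpolant may replace \<open>f\<close>. No continuity of \<open>f\<close> is needed at
  this stage, where none is known.\<close>

lemma fun_calc_two_eigen:
  assumes u: "norm (u::'a::complex_hilbert) = 1"
  shows "fun_calc f (two_eigen x y u) = two_eigen (f x) (f y) u"
proof (rule fun_calc_eq[OF selfadjoint_two_eigen])
  \<comment> \<open>For \<open>x = y\<close> division by zero makes \<open>a = 0\<close>, and the
    identity \<open>a\<close> below still holds.\<close>
  define a where "a = (f y - f x) / (y - x)"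
  define p where "p = [:f x - a * x, a:]"
  have a: "a * (y - x) = f y - f x" by (auto simp: a_def)
  then have p: "poly p x = f x" "poly p y = f y"
    by (simp_all add: p_def algebra_simps)
  have "op_poly p (two_eigen x y u) = f x *\<^sub>R id_blinfun + (a * (y - x)) *\<^sub>R rank_one u"
    unfolding p_def two_eigen_def
    by (intro blinfun_eqI) (simp add: blinfun.bilinear_simps scaleR_diff_left algebra_simps)
  then have "op_poly p (two_eigen x y u) = two_eigen (f x) (f y) u"
    by (simp only: two_eigen_def a)
  moreover have "fc_limit (poly p) (two_eigen x y u) (op_poly p (two_eigen x y u))"
    by (rule fc_limit_poly)
  moreover have "poly p t = f t" if "t \<in> real_spectrum (two_eigen x y u)" for t
    using two_eigen_spectrum[OF u, of x y] that p by (auto simp: real_spectrum_def)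
  ultimately show "fc_limit f (two_eigen x y u) (two_eigen (f x) (f y) u)"
    using fc_limit_cong by metis
qed

section \<open>A coordinate plane of the sequence space\<close>

definition ell2_basis :: "nat \<Rightarrow> ell2" where
  "ell2_basis k = Abs_ell2 (\<lambda>n. if n = k then 1 else 0)"

lemma ell2_nth_basis: "ell2_nth (ell2_basis k) n = (if n = k then 1 else 0)"
proof -
  have "summable (\<lambda>n. (cmod (if n = k then 1 else 0))\<^sup>2)"
    by (rule summable_finite[of "{k}"]) auto
  then show ?thesis by (simp add: ell2_basis_def Abs_ell2_inverse)
qed

lemma cinner_ell2_basis: "cinner v (ell2_basis k) = ell2_nth v k"
proof -
  have "(\<lambda>n. ell2_nth v n * cnj (ell2_nth (ell2_basis k) n)) sums (\<Sum>n\<in>{k}. ell2_nth v n * cnj (ell2_nth (ell2_basis k) n))"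
    by (rule sums_finite) (auto simp: ell2_nth_basis)
  then show ?thesis by (simp add: cinner_ell2.rep_eq sums_iff ell2_nth_basis)
qed

lemma cinner_scaleR_right: "cinner x (r *\<^sub>R y) = complex_of_real r * cinner x (y::'a::complex_inner)"
  by (metis cinner_scaleC_right complex_cnj_complex_of_real scaleC_of_real)

abbreviation plane_vector :: "real \<Rightarrow> real \<Rightarrow> ell2" where
  "plane_vector a b \<equiv> a *\<^sub>R ell2_basis 0 + b *\<^sub>R ell2_basis 1"

lemma ell2_nth_plane:
  "ell2_nth (plane_vector a b) n = (if n = 0 then of_real a else if n = 1 then of_real b else 0)"
  by (simp add: plus_ell2.rep_eq scaleR_ell2.rep_eq ell2_nth_basis)

lemma norm_plane_vector: "(norm (plane_vector a b))\<^sup>2 = a\<^sup>2 + b\<^sup>2"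
proof -
  have "(\<lambda>n. (cmod (ell2_nth (plane_vector a b) n))\<^sup>2) sums (\<Sum>n\<in>{0, 1}. (cmod (ell2_nth (plane_vector a b) n))\<^sup>2)"
    by (rule sums_finite) (simp_all only: ell2_nth_plane, simp_all)
  then have "(norm (plane_vector a b))\<^sup>2 = (\<Sum>n\<in>{0, 1}. (cmod (ell2_nth (plane_vector a b) n))\<^sup>2)"
    using norm_ell2_sums sums_unique2 by blast
  then show ?thesis by (simp only: ell2_nth_plane) simp
qed

lemma cinner_plane_vector:
  "cinner v (plane_vector a b) = of_real a * ell2_nth v 0 + of_real b * ell2_nth v 1"
  by (simp add: cinner_add_right cinner_scaleR_right cinner_ell2_basis)

text \<open>
  Comparing \<open>two_eigen x y u\<close>, where \<open>u\<close> is the unit vector \<open>(c, s)\<close> of a coordinate plane, with a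
  larger operator diagonal in the coordinate basis. For \<open>b = 1\<close>, \<open>a = 0\<close> the conclusion is concavity
  of \<open>f\<close> up to \<open>\<epsilon>\<close>; as a positive form in \<open>a\<close>, \<open>b\<close> it yields the Loewner inequality.
\<close>

lemma operator_monotone_form_nonneg:
  assumes f: "operator_monotone {0<..} f" and "x > 0" "y > 0" and e: "\<epsilon> > 0" and cs: "c\<^sup>2 + s\<^sup>2 = 1"
    and p: "p = x + (y - x) * s\<^sup>2 + \<epsilon>" "p \<ge> x"
    and q: "q = x + (y - x) * c\<^sup>2 + ((y - x) * c * s)\<^sup>2 / \<epsilon>"
  shows "0 \<le> (f q - f x) * a\<^sup>2 + (f p - f x) * b\<^sup>2 - (f y - f x) * (c * a + s * b)\<^sup>2"
proof -
  have norm_one_iff: "norm v = 1 \<longleftrightarrow> (norm v)\<^sup>2 = 1" for v :: ell2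
    using power2_eq_iff_nonneg[of "norm v" 1] by simp
  define u where "u = plane_vector c s"
  define e0 where "e0 = plane_vector 1 0"
  have u: "norm u = 1" using norm_plane_vector[of c s] cs by (simp only: u_def norm_one_iff)
  have e0: "norm e0 = 1" using norm_plane_vector[of 1 0] by (simp only: e0_def norm_one_iff) simp
  have "x * s\<^sup>2 + y * c\<^sup>2 > 0"
    using cs \<open>x > 0\<close> \<open>y > 0\<close> by (cases "s = 0") (auto intro: add_pos_nonneg)
  moreover have "x * s\<^sup>2 + y * c\<^sup>2 = x + (y - x) * c\<^sup>2"
  proof -
    have s: "s\<^sup>2 = 1 - c\<^sup>2" using cs by simp
    show ?thesis unfolding s by (simp add: algebra_simps)
  qed
  ultimately have qp: "q > 0" unfolding q using e by (simp add: add_pos_nonneg)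
  have pp: "p > 0" using p \<open>x > 0\<close> by simp
  have le: "two_eigen x y u \<preceq> two_eigen p q e0"
    unfolding op_le_def pos_semidef_iff
  proof (intro conjI allI)
    show "selfadjoint (two_eigen p q e0 - two_eigen x y u)"
      by (intro selfadjoint_diff selfadjoint_two_eigen)
    fix v
    define \<alpha> where "\<alpha> = ell2_nth v 0"
    define \<beta> where "\<beta> = ell2_nth v 1"
    have "(\<Sum>n\<in>{0,1}. (cmod (ell2_nth v n))\<^sup>2) \<le> (norm v)\<^sup>2" by (rule sum_le_norm_ell2) simp
    \<comment> \<open>On the orthogonal complement of the plane the difference of the two operators
      is \<open>p - x\<close>, which is why \<open>p \<ge> x\<close> is required.\<close>
    then have "(p - x) * ((cmod \<alpha>)\<^sup>2 + (cmod \<beta>)\<^sup>2) \<le> (p - x) * (norm v)\<^sup>2"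
      using p by (intro mult_left_mono) (auto simp: \<alpha>_def \<beta>_def)
    moreover have "(y - x) * (cmod (of_real c * \<alpha> + of_real s * \<beta>))\<^sup>2
        \<le> (q - p) * (cmod \<alpha>)\<^sup>2 + (p - x) * ((cmod \<alpha>)\<^sup>2 + (cmod \<beta>)\<^sup>2)"
    proof -
      define k where "k = (y - x) * c * s"
      define K where "K = k\<^sup>2 / \<epsilon>"
      \<comment> \<open>Within the plane the difference has the matrix with diagonal
        \<open>k\<^sup>2 / \<epsilon>\<close>, \<open>\<epsilon>\<close> and off-diagonal entries
        \<open>- k\<close>. Its determinant is zero, which explains the correction terms in
        \<open>q\<close> and \<open>p\<close>.\<close>
      have sq: "0 \<le> k\<^sup>2 / \<epsilon> * a\<^sup>2 + \<epsilon> * b\<^sup>2 - 2 * k * a * b" for a b :: real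
      proof -
        have "0 \<le> (k * a - \<epsilon> * b)\<^sup>2 / \<epsilon>" using e by simp
        also have "\<dots> = k\<^sup>2 / \<epsilon> * a\<^sup>2 + \<epsilon> * b\<^sup>2 - 2 * k * a * b"
          using e by (simp add: field_simps power2_eq_square)
        finally show ?thesis .
      qed
      have "(q - p) * (cmod \<alpha>)\<^sup>2 + (p - x) * ((cmod \<alpha>)\<^sup>2 + (cmod \<beta>)\<^sup>2)
          - (y - x) * (cmod (of_real c * \<alpha> + of_real s * \<beta>))\<^sup>2
        = (q - x) * (cmod \<alpha>)\<^sup>2 + (p - x) * (cmod \<beta>)\<^sup>2
          - (y - x) * (cmod (of_real c * \<alpha> + of_real s * \<beta>))\<^sup>2"
        by (simp add: algebra_simps)
      also have "\<dots> = (k\<^sup>2 / \<epsilon> * (Re \<alpha>)\<^sup>2 + \<epsilon> * (Re \<beta>)\<^sup>2 - 2 * k * Re \<alpha> * Re \<beta>)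
          + (k\<^sup>2 / \<epsilon> * (Im \<alpha>)\<^sup>2 + \<epsilon> * (Im \<beta>)\<^sup>2 - 2 * k * Im \<alpha> * Im \<beta>)"
        unfolding p(1) q cmod_power2 k_def[symmetric] K_def[symmetric]
        by (simp add: k_def algebra_simps power2_eq_square)
      finally show ?thesis using sq[of "Re \<alpha>" "Re \<beta>"] sq[of "Im \<alpha>" "Im \<beta>"] by linarith
    qed
    moreover have "cinner v u = of_real c * \<alpha> + of_real s * \<beta>" "cinner v e0 = \<alpha>"
      unfolding u_def e0_def cinner_plane_vector \<alpha>_def \<beta>_def by simp_all
    ultimately show "0 \<le> inner (blinfun_apply (two_eigen p q e0 - two_eigen x y u) v) v"
      by (simp add: blinfun.diff_left inner_diff_left inner_two_eigen) (simp add: algebra_simps)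
  qed
  have "spectrum (two_eigen x y u) \<subseteq> complex_of_real ` {0<..}"
    using two_eigen_spectrum[OF u, of x y] \<open>x > 0\<close> \<open>y > 0\<close> by auto
  moreover have "spectrum (two_eigen p q e0) \<subseteq> complex_of_real ` {0<..}"
    using two_eigen_spectrum[OF e0, of p q] pp qp by auto
  ultimately have "fun_calc f (two_eigen x y u) \<preceq> fun_calc f (two_eigen p q e0)"
    using f le selfadjoint_two_eigen unfolding operator_monotone_def operator_monotone_in_def by blast
  then have "0 \<le> inner (blinfun_apply (two_eigen (f p) (f q) e0 - two_eigen (f x) (f y) u) v) v" for v
    by (simp add: op_le_def pos_semidef_iff fun_calc_two_eigen u e0)
  \<comment> \<open>A test vector inside the plane, so that the complement contributes
    nothing.\<close>
  from this[of "plane_vector a b"]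
  have "0 \<le> f p * (a\<^sup>2 + b\<^sup>2) + (f q - f p) * (cmod (complex_of_real a))\<^sup>2
      - (f x * (a\<^sup>2 + b\<^sup>2) + (f y - f x) * (cmod (complex_of_real (c * a + s * b)))\<^sup>2)"
    unfolding blinfun.diff_left inner_diff_left inner_two_eigen norm_plane_vector
      u_def e0_def cinner_plane_vector ell2_nth_plane by simp
  then show ?thesis
    by (simp only: norm_of_real power2_abs) (simp add: algebra_simps)
qed

section \<open>Operator monotone functions on the positive half-line\<close>

text \<open>With \<open>a = 0\<close> and \<open>b = 1\<close> the entry \<open>q\<close> drops out
  of the form, so its growth as \<open>\<epsilon>\<close> shrinks does no harm. The condition
  \<open>p \<ge> x\<close> demands \<open>x \<le> y\<close>; the other order follows by exchanging
  the points.\<close>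

lemma operator_monotone_almost_concave:
  assumes f: "operator_monotone {0<..} f" and "x > 0" "y > 0" "\<epsilon> > 0" and t: "0 \<le> t" "t \<le> 1"
  shows "(1 - t) * f x + t * f y \<le> f ((1 - t) * x + t * y + \<epsilon>)"
proof -
  have *: "(1 - t) * f x + t * f y \<le> f ((1 - t) * x + t * y + \<epsilon>)"
    if "0 < x" "x \<le> y" "0 \<le> t" "t \<le> 1" for x y t :: real
  proof -
    define p where "p = x + (y - x) * t + \<epsilon>"
    have "0 \<le> (f p - f x) - (f y - f x) * t"
      using operator_monotone_form_nonneg[OF f, of x y \<epsilon> "sqrt (1 - t)" "sqrt t" p _ 0 1] that \<open>\<epsilon> > 0\<close>
      by (simp add: p_def)
    then show ?thesis by (simp add: p_def algebra_simps)
  qed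
  show ?thesis
  proof (cases "x \<le> y")
    case True
    then show ?thesis using * assms by simp
  next
    case False
    then show ?thesis using *[of y x "1 - t"] assms by (simp add: add.commute)
  qed
qed

lemma operator_monotone_mono:
  assumes "operator_monotone {0<..} f" "0 < x" "x \<le> y"
  shows "f x \<le> f y"
  using operator_monotone_almost_concave[OF assms(1), of x x "y - x" 0] assms(2,3)
  by (cases "x = y") auto

text \<open>Letting \<open>\<epsilon>\<close> tend to 0 inside \<open>f\<close> would require
  continuity, which is not known yet. The argument \<open>m\<close> is kept fixed instead: the
  weight \<open>t'\<close> stays below \<open>t\<close>, and \<open>(t - t') * (y - x)\<close>
  serves as \<open>\<epsilon>\<close>. The limit then concerns only the affine left-hand
  side.\<close>

lemma operator_monotone_concave:
  assumes f: "operator_monotone {0<..} f"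
  shows "concave_on {0<..} f"
  unfolding concave_on_def
proof (rule convex_on_linorderI)
  fix t x y :: real
  assume t: "0 < t" "t < 1" and xy: "x \<in> {0<..}" "y \<in> {0<..}" "x < y"
  define m where "m = (1 - t) * x + t * y"
  define D where "D = f y - f x"
  have *: "f x + t' * D \<le> f m" if "0 \<le> t'" "t' < t" for t'
  proof -
    have "(1 - t') * f x + t' * f y \<le> f ((1 - t') * x + t' * y + (t - t') * (y - x))"
      using that t xy by (intro operator_monotone_almost_concave f) auto
    also have "(1 - t') * x + t' * y + (t - t') * (y - x) = m" by (simp add: m_def algebra_simps)
    finally show ?thesis by (simp add: D_def algebra_simps)
  qed
  have "f x + t * D \<le> f m"
  proof (rule tendsto_upperbound)
    show "((\<lambda>t'. f x + t' * D) \<longlongrightarrow> f x + t * D) (at_left t)"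
      by (intro tendsto_intros)
    show "\<forall>\<^sub>F t' in at_left t. f x + t' * D \<le> f m"
      using eventually_at_left_real[OF t(1)] by eventually_elim (use * in auto)
  qed simp
  then show "- f ((1 - t) *\<^sub>R x + t *\<^sub>R y) \<le> (1 - t) * - f x + t * - f y"
    by (simp add: m_def D_def algebra_simps)
qed simp

section \<open>Supergradients, the Loewner inequality and differentiability\<close>

lemma concave_on_supergradient_ex:
  fixes f :: "real \<Rightarrow> real"
  assumes "concave_on {0<..} f" "x > 0"
  obtains \<sigma> where "\<And>y. y > 0 \<Longrightarrow> f y \<le> f x + \<sigma> * (y - x)"
proof -
  \<comment> \<open>The right derivative of the convex function \<open>- f\<close> at
    \<open>x\<close>, as the infimum of the slopes to the right.\<close>
  define c where "c = Inf ((\<lambda>t. (- f x - - f t) / (x - t)) ` ({x<..} \<inter> {0<..}))"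
  have "- f y \<ge> - f x + c * (y - x)" if "y > 0" for y
    unfolding c_def using assms that
    by (intro convex_le_Inf_differential) (auto simp: concave_on_def interior_open)
  then show thesis by (intro that[of "- c"]) force
qed

text \<open>For \<open>x \<noteq> y\<close> this is nonnegativity of the determinant of the 2x2
  Loewner matrix, with supergradients for derivatives, since differentiability is yet to be deduced
  from it. Taking \<open>\<epsilon> = s\<close> in the rotated block makes \<open>p - x\<close> and
  \<open>q - y\<close> of first order in \<open>s\<close>. Bounding \<open>f p\<close> and
  \<open>f q\<close> by the supergradients, dividing by \<open>s\<close> and letting
  \<open>s\<close> tend to 0 leaves a nonnegative quadratic polynomial in \<open>b\<close>.\<close>

lemma operator_monotone_loewner:
  assumes f: "operator_monotone {0<..} f" and x: "x > 0" and y: "y > 0"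
    and \<sigma>: "\<And>z. z > 0 \<Longrightarrow> f z \<le> f x + \<sigma> * (z - x)"
    and \<tau>: "\<And>z. z > 0 \<Longrightarrow> f z \<le> f y + \<tau> * (z - y)"
  shows "(f y - f x)\<^sup>2 \<le> \<sigma> * \<tau> * (y - x)\<^sup>2"
proof -
  define d where "d = y - x"
  define D where "D = f y - f x"
  have \<sigma>0: "\<sigma> \<ge> 0" using \<sigma>[of "x + 1"] operator_monotone_mono[OF f x, of "x + 1"] x by simp
  have form: "0 \<le> \<tau> * d\<^sup>2 - 2 * D * b + \<sigma> * b\<^sup>2" for b
  proof (rule tendsto_lowerbound)
    let ?G = "\<lambda>s. \<tau> * (- d * s + d\<^sup>2 * (1 - s\<^sup>2)) + D * s - 2 * D * sqrt (1 - s\<^sup>2) * b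
        + (\<sigma> * (d * s + 1) - D * s) * b\<^sup>2"
    show "(?G \<longlongrightarrow> \<tau> * d\<^sup>2 - 2 * D * b + \<sigma> * b\<^sup>2) (at_right 0)"
      by (auto intro!: tendsto_eq_intros)
    \<comment> \<open>For \<open>s < r\<close> this ensures \<open>s < 1\<close> and
      \<open>\<bar>d * s\<bar> \<le> 1\<close>, hence \<open>p \<ge> x\<close>.\<close>
    define r where "r = min 1 (1 / (\<bar>d\<bar> + 1))"
    have r: "r > 0" "r \<le> 1" "r * (\<bar>d\<bar> + 1) \<le> 1" by (auto simp: r_def min_def field_simps)
    have "\<forall>\<^sub>F s in at_right 0. s \<in> {0<..<r}"
      by (rule eventually_at_right_real[OF r(1)])
    then show "\<forall>\<^sub>F s in at_right 0. 0 \<le> ?G s"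
    proof eventually_elim
      case (elim s)
      then have s: "0 < s" "s < 1" using r by auto
      have "s * \<bar>d\<bar> \<le> r * (\<bar>d\<bar> + 1)" using elim by (intro mult_mono) auto
      then have "\<bar>d * s\<bar> \<le> 1" using r s by (simp add: abs_mult mult.commute)
      then have ds: "d * s + 1 \<ge> 0" by linarith
      define c where "c = sqrt (1 - s\<^sup>2)"
      have c2: "c\<^sup>2 = 1 - s\<^sup>2" using s by (simp add: c_def power_le_one)
      define p where "p = x + d * s\<^sup>2 + s"
      define q where "q = x + d * c\<^sup>2 + (d * c * s)\<^sup>2 / s"
      have px: "p - x = s * (d * s + 1)" by (simp add: p_def power2_eq_square algebra_simps)
      have "0 \<le> s * (d * s + 1)" using s ds by (intro mult_nonneg_nonneg) auto
      then have pge: "p \<ge> x" using px by linarith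
      have qy: "q - y = s * (- d * s + d\<^sup>2 * (1 - s\<^sup>2))"
        using s by (simp add: q_def c2 power_mult_distrib d_def) (simp add: power2_eq_square field_simps)
      have "x + d * c\<^sup>2 = x * s\<^sup>2 + y * c\<^sup>2" unfolding c2 d_def by (simp add: algebra_simps)
      moreover have "x * s\<^sup>2 + y * c\<^sup>2 > 0" using s x y by (intro add_pos_nonneg mult_pos_pos mult_nonneg_nonneg) auto
      ultimately have q0: "q > 0" unfolding q_def using s by (simp add: add_pos_nonneg)
      have "0 \<le> (f q - f x) * 1\<^sup>2 + (f p - f x) * b\<^sup>2 - D * (c * 1 + s * b)\<^sup>2"
        unfolding D_def
        by (rule operator_monotone_form_nonneg[OF f x y s(1) _ p_def[unfolded d_def] pge q_def[unfolded d_def]])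
          (simp add: c2)
      also have "\<dots> = (f q - f y + D * s\<^sup>2) - 2 * D * c * s * b + (f p - f x - D * s\<^sup>2) * b\<^sup>2"
        by (simp add: power2_sum power_mult_distrib c2 D_def algebra_simps)
      also have "\<dots> \<le> (\<tau> * (q - y) + D * s\<^sup>2) - 2 * D * c * s * b + (\<sigma> * (p - x) - D * s\<^sup>2) * b\<^sup>2"
        using \<sigma>[of p] \<tau>[OF q0] pge x by (intro add_mono diff_mono mult_right_mono order.refl) auto
      also have "\<dots> = s * ?G s"
        unfolding px qy c_def by (simp add: power2_eq_square algebra_simps)
      finally show ?case using s by (simp add: zero_le_mult_iff)
    qed
  qed simp
  show ?thesis
  proof (cases "\<sigma> = 0")
    case True
    have "D = 0"
    proof (rule ccontr)
      assume "D \<noteq> 0"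
      \<comment> \<open>For \<open>\<sigma> = 0\<close> the polynomial is affine in
        \<open>b\<close>, and this \<open>b\<close> gives it the value -1.\<close>
      then show False using form[of "(\<tau> * d\<^sup>2 + 1) / (2 * D)"] True by simp
    qed
    then show ?thesis using True by (simp add: D_def)
  next
    case False
    then have \<sigma>: "\<sigma> > 0" using \<sigma>0 by simp
    \<comment> \<open>The minimiser \<open>b = D / \<sigma>\<close>.\<close>
    have "0 \<le> \<tau> * d\<^sup>2 - 2 * D * (D / \<sigma>) + \<sigma> * (D / \<sigma>)\<^sup>2" by (rule form)
    also have "\<dots> = \<tau> * d\<^sup>2 - D\<^sup>2 / \<sigma>"
      using \<sigma> by (simp add: power2_eq_square)
    finally have "D\<^sup>2 \<le> \<sigma> * \<tau> * d\<^sup>2"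
      using \<sigma> by (simp add: pos_divide_le_eq mult_ac)
    then show ?thesis by (simp add: D_def d_def)
  qed
qed

text \<open>
  The left derivative \<open>L\<close> and the right derivative \<open>R\<close> at \<open>a\<close> coincide: the supergradients at
  \<open>a - h\<close> tend to \<open>L\<close>, so the Loewner inequality with \<open>R\<close> at \<open>a\<close> yields \<open>L\<^sup>2 \<le> L * R\<close>.
\<close>

lemma operator_monotone_differentiable:
  assumes f: "operator_monotone {0<..} f" and a: "a > 0"
  obtains c where "\<And>t. t > 0 \<Longrightarrow> f t \<le> f a + c * (t - a)"
    and "(f has_real_derivative c) (at a)"
proof -
  note conc = operator_monotone_concave[OF f]
  define d where "d t = (f t - f a) / (t - a)" for t
  have fd: "f t = f a + d t * (t - a)" for t by (simp add: d_def)
  have chord: "f a + d b * (t - a) \<le> f t" if "b > 0" "b \<noteq> a" "0 \<le> (t - a) / (b - a)" "(t - a) / (b - a) \<le> 1" for b t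
  proof -
    define l where "l = (t - a) / (b - a)"
    have "l * (b - a) = t - a" using that(2) by (simp add: l_def)
    then have tl: "t = (1 - l) * a + l * b" by (simp add: algebra_simps)
    have "(1 - l) * f a + l * f b \<le> f ((1 - l) *\<^sub>R a + l *\<^sub>R b)"
      using conc that a unfolding concave_on_iff l_def[symmetric] by auto
    also have "(1 - l) *\<^sub>R a + l *\<^sub>R b = t" by (simp add: tl)
    also have "(1 - l) * f a + l * f b = f a + d b * (t - a)"
    proof -
      have "d b * (t - a) = l * (f b - f a)" by (simp add: d_def l_def)
      then show ?thesis by (simp add: algebra_simps)
    qed
    finally show ?thesis .
  qed
  obtain \<sigma>0 where \<sigma>0: "\<And>y. y > 0 \<Longrightarrow> f y \<le> f a + \<sigma>0 * (y - a)"
    using concave_on_supergradient_ex[OF conc a] by blast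
  \<comment> \<open>By concavity the slopes \<open>d\<close> decrease, so the one-sided derivatives
    are this supremum and the infimum below; no limits have to be taken.\<close>
  define R where "R = Sup (d ` {a<..})"
  define L where "L = Inf (d ` {0<..<a})"
  have dr: "d t \<le> \<sigma>0" if "t > a" for t
    using \<sigma>0[of t] that a by (simp add: d_def field_simps)
  have dl: "\<sigma>0 \<le> d t" if "0 < t" "t < a" for t
    using \<sigma>0[of t] that a by (simp add: d_def field_simps)
  have bdd: "bdd_above (d ` {a<..})" "bdd_below (d ` {0<..<a})"
    using dr dl by (auto intro!: bdd_aboveI2 bdd_belowI2)
  have ne: "d ` {a<..} \<noteq> {}" "d ` {0<..<a} \<noteq> {}" using a by auto
  have dR: "d t \<le> R" if "t > a" for t unfolding R_def using bdd that by (intro cSup_upper) auto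
  have dL: "L \<le> d t" if "0 < t" "t < a" for t unfolding L_def using bdd that by (intro cInf_lower) auto
  have "R \<le> \<sigma>0" unfolding R_def using ne dr by (intro cSup_least) auto
  moreover have "\<sigma>0 \<le> L" unfolding L_def using ne dl by (intro cInf_greatest) auto
  ultimately have RL: "R \<le> L" by simp
  have R: "f t \<le> f a + R * (t - a)" if "t > 0" for t
  proof (cases t a rule: linorder_cases)
    case less
    then have "R \<le> d t" using dL[OF that] RL by linarith
    then have "d t * (t - a) \<le> R * (t - a)" using less by (intro mult_right_mono_neg) auto
    then show ?thesis using fd[of t] by simp
  next
    case greater
    then have "d t * (t - a) \<le> R * (t - a)" using dR[of t] by (intro mult_right_mono) auto
    then show ?thesis using fd[of t] by simp
  qed simp
  have R0: "R \<ge> 0" using R[of "a + 1"] operator_monotone_mono[OF f a, of "a + 1"] a by simp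
  have key: "L\<^sup>2 \<le> (2 * d t - L) * R" if t: "0 < t" "t < a" for t
  proof -
    \<comment> \<open>The midpoint \<open>x\<close> of \<open>t\<close> and \<open>a\<close>: a
      supergradient there is at most the slope from \<open>t\<close> to \<open>x\<close>, which is
      \<open>2 * d t - d x\<close>.\<close>
    define h where "h = (a - t) / 2"
    define x where "x = a - h"
    have h: "h > 0" "x > 0" "x < a" "t = x - h" using t by (auto simp: h_def x_def field_simps)
    obtain \<sigma> where \<sigma>: "\<And>y. y > 0 \<Longrightarrow> f y \<le> f x + \<sigma> * (y - x)"
      using concave_on_supergradient_ex[OF conc h(2)] by blast
    have "f t \<le> f x - \<sigma> * h" using \<sigma>[OF t(1)] h(4) by simp
    moreover have "f t = f a - 2 * d t * h"
    proof -
      have "t - a = - (2 * h)" by (simp add: h_def field_simps)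
      then show ?thesis using fd[of t] by simp
    qed
    moreover have fx: "f x = f a - d x * h" using fd[of x] by (simp add: x_def)
    ultimately have "\<sigma> * h \<le> (2 * d t - d x) * h" by (simp add: algebra_simps)
    then have "\<sigma> \<le> 2 * d t - d x" using h by simp
    then have s: "\<sigma> \<le> 2 * d t - L" using dL[of x] h by simp
    have "(f a - f x)\<^sup>2 \<le> \<sigma> * R * (a - x)\<^sup>2"
      by (rule operator_monotone_loewner[OF f h(2) a \<sigma> R])
    moreover have "f a - f x = d x * h" "a - x = h" using fx by (simp_all add: x_def)
    ultimately have "(d x)\<^sup>2 * h\<^sup>2 \<le> \<sigma> * R * h\<^sup>2" by (simp only: power_mult_distrib)
    then have "(d x)\<^sup>2 \<le> \<sigma> * R" using h by simp
    moreover have "L\<^sup>2 \<le> (d x)\<^sup>2" using dL[of x] h R0 RL by (intro power_mono) auto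
    moreover have "\<sigma> * R \<le> (2 * d t - L) * R" using s R0 by (rule mult_right_mono)
    ultimately show ?thesis by linarith
  qed
  have "L \<le> R"
  proof (cases "R = 0")
    case True
    then show ?thesis using key[of "a / 2"] a by simp
  next
    case False
    then have Rp: "R > 0" using R0 by simp
    \<comment> \<open>By \<open>key\<close> the left-hand side is a lower bound of all slopes
      \<open>d t\<close> with \<open>t < a\<close>, hence of their infimum.\<close>
    have "(L\<^sup>2 / R + L) / 2 \<le> L"
      unfolding L_def by (rule cInf_greatest[OF ne(2)], fold L_def) (use key Rp in \<open>auto simp: field_simps\<close>)
    then have "L * L \<le> L * R" using Rp by (simp add: field_simps power2_eq_square)
    then show ?thesis using RL Rp by simp
  qed
  with RL have eq: "L = R" by simp
  show thesis
  proof (rule that[of R])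
    show "f t \<le> f a + R * (t - a)" if "t > 0" for t by (rule R[OF that])
    have "\<exists>\<delta>>0. \<forall>t. norm (t - a) < \<delta> \<longrightarrow> norm (f t - f a - R * (t - a)) \<le> \<epsilon> * norm (t - a)"
      if \<epsilon>: "\<epsilon> > 0" for \<epsilon>
    proof -
      \<comment> \<open>Near \<open>a\<close>, the chords to \<open>t1\<close> and
        \<open>t0\<close>, with slopes within \<open>\<epsilon>\<close> of \<open>R\<close>, bound
        \<open>f\<close> from below, and the supporting line bounds it from above.\<close>
      have "R - \<epsilon> < Sup (d ` {a<..})" unfolding R_def[symmetric] using \<epsilon> by simp
      then obtain t1 where t1: "t1 > a" "R - \<epsilon> < d t1" using less_cSup_iff[OF ne(1) bdd(1)] by auto
      have "Inf (d ` {0<..<a}) < R + \<epsilon>" unfolding L_def[symmetric] eq using \<epsilon> by simp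
      then obtain t0 where t0: "0 < t0" "t0 < a" "d t0 < R + \<epsilon>" using cInf_less_iff[OF ne(2) bdd(2)] by auto
      show ?thesis
      proof (intro exI[of _ "min (t1 - a) (a - t0)"] conjI allI impI)
        show "min (t1 - a) (a - t0) > 0" using t0 t1 by simp
        fix t assume "norm (t - a) < min (t1 - a) (a - t0)"
        then have t: "\<bar>t - a\<bar> < min (t1 - a) (a - t0)" by simp
        have "f a + R * (t - a) - \<epsilon> * \<bar>t - a\<bar> \<le> f t"
        proof (cases "t \<ge> a")
          case True
          have "(R - \<epsilon>) * (t - a) \<le> d t1 * (t - a)" using t1 True by (intro mult_right_mono) auto
          moreover have "f a + d t1 * (t - a) \<le> f t"
            using True t t1 a by (intro chord) (auto simp: field_simps)
          ultimately show ?thesis using True by (simp add: algebra_simps)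
        next
          case False
          have "(R + \<epsilon>) * (t - a) \<le> d t0 * (t - a)" using t0 False by (intro mult_right_mono_neg) auto
          moreover have "f a + d t0 * (t - a) \<le> f t"
            using False t t0 a by (intro chord) (auto simp: field_simps)
          ultimately show ?thesis using False by (simp add: algebra_simps)
        qed
        moreover have "f t \<le> f a + R * (t - a)" using t t0 by (intro R) auto
        moreover have "0 \<le> \<epsilon> * \<bar>t - a\<bar>" using \<epsilon> by simp
        ultimately show "norm (f t - f a - R * (t - a)) \<le> \<epsilon> * norm (t - a)"
          unfolding real_norm_def abs_le_iff by linarith
      qed
    qed
    then show "(f has_real_derivative R) (at a)"
      unfolding has_field_derivative_def has_derivative_at_alt
      by (simp add: bounded_linear_mult_right)
  qed
qed

lemma operator_monotone_positive_slope:
  assumes f: "operator_monotone {0<..} f" and a: "a > 0" and nc: "\<not> f constant_on {0<..}"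
    and c: "\<And>t. t > 0 \<Longrightarrow> f t \<le> f a + c * (t - a)"
  shows "c > 0"
proof -
  have "c \<ge> 0" using c[of "a + 1"] operator_monotone_mono[OF f a, of "a + 1"] a by simp
  moreover have "c \<noteq> 0"
  proof
    assume "c = 0"
    have "f y = f a" if y: "y > 0" for y
    proof -
      obtain \<tau> where "\<And>z. z > 0 \<Longrightarrow> f z \<le> f y + \<tau> * (z - y)"
        using concave_on_supergradient_ex[OF operator_monotone_concave[OF f] y] by blast
      from operator_monotone_loewner[OF f a y c this] show ?thesis using \<open>c = 0\<close> by simp
    qed
    then show False using nc by (auto simp: constant_on_def)
  qed
  ultimately show ?thesis by simp
qed

section \<open>Functional calculus near the identity\<close>

lemma inner_weighted_sum:
  "inner (blinfun_apply (\<Sum>i\<in>I. w i *\<^sub>R A i) x) y = (\<Sum>i\<in>I. w i * inner (blinfun_apply (A i) x) y)"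
  by (simp add: blinfun.sum_left blinfun.scaleR_left inner_sum_left)

lemma fc_limit_ge:
  assumes A: "selfadjoint A" and fc: "fc_limit f A B"
    and p: "\<And>t. t \<in> real_spectrum A \<Longrightarrow> poly p t \<le> f t"
  shows "inner (blinfun_apply (op_poly p A) x) x \<le> inner (blinfun_apply B x) x"
proof -
  have "pos_semidef (B - op_poly p A)"
    by (rule fc_limit_nonneg[OF A fc_limit_diff[OF fc fc_limit_poly]]) (use p in simp)
  then show ?thesis by (simp add: pos_semidef_iff blinfun.diff_left inner_diff_left)
qed

lemma fc_limit_le:
  assumes A: "selfadjoint A" and fc: "fc_limit f A B"
    and p: "\<And>t. t \<in> real_spectrum A \<Longrightarrow> f t \<le> poly p t"
  shows "inner (blinfun_apply B x) x \<le> inner (blinfun_apply (op_poly p A) x) x"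
proof -
  have "pos_semidef (op_poly p A - B)"
    by (rule fc_limit_nonneg[OF A fc_limit_diff[OF fc_limit_poly fc]]) (use p in simp)
  then show ?thesis by (simp add: pos_semidef_iff blinfun.diff_left inner_diff_left)
qed

lemma fc_limit_inverse:
  assumes A: "selfadjoint A" and f: "fc_limit f A B" and g: "fc_limit g A C"
    and fg: "\<And>t. t \<in> real_spectrum A \<Longrightarrow> f t * g t = 1"
  shows "is_op_inverse B C"
proof -
  have id: "fc_limit h A id_blinfun" if "\<And>t. t \<in> real_spectrum A \<Longrightarrow> h t = 1" for h
    using fc_limit_poly[of "[:1:]" A] fc_limit_cong[of A h "poly [:1:]"] that by simp
  have "(B o\<^sub>L C) = id_blinfun"
    by (rule fc_limit_unique[OF A fc_limit_mult[OF A f g] id]) (rule fg)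
  moreover have "(C o\<^sub>L B) = id_blinfun"
    by (rule fc_limit_unique[OF A fc_limit_mult[OF A g f] id]) (simp add: fg mult.commute)
  ultimately show ?thesis
    using fc_limit_selfadjoint[OF A g] by (simp add: is_op_inverse_def selfadjoint_clinear)
qed

text \<open>The spectrum lies in \<open>{1 - r..1 + r}\<close>, inside the open half-line, where
  \<open>f\<close> is continuous as a concave function and positive. The last claim, with the
  constant \<open>1 / f (1 + r)\<close> from monotonicity, makes weighted sums of the inverses
  coercive, hence invertible.\<close>

lemma OM1_fun_calc:
  assumes f: "f \<in> OM1" and A: "selfadjoint A" and r: "norm (A - id_blinfun) \<le> r" "r < 1"
  shows "fc_limit f A (fun_calc f A)"
    and "pos_def (fun_calc f A)"
    and "fc_limit (\<lambda>t. inverse (f t)) A (op_inverse (fun_calc f A))"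
    and "\<exists>m>0. \<forall>x. m * (norm x)\<^sup>2 \<le> inner (blinfun_apply (op_inverse (fun_calc f A)) x) x"
proof -
  have om: "operator_monotone {0<..} f" and pos: "\<And>t. t > 0 \<Longrightarrow> f t > 0"
    using f by (auto simp: OM1_def)
  have rs: "real_spectrum A \<subseteq> {1 - r..1 + r}"
    using spectrum_subset_interval[OF A, of 1 r] r by (auto simp: real_spectrum_def)
  have "convex_on {0<..} (\<lambda>t. - f t)"
    using operator_monotone_concave[OF om] by (simp add: concave_on_def)
  then have "continuous_on {0<..} (\<lambda>t. - (- f t))"
    by (intro continuous_on_minus convex_on_continuous) auto
  then have cont: "continuous_on {1 - r..1 + r} f"
    using r by (auto elim!: continuous_on_subset)
  have r0: "0 \<le> r" using r by (meson norm_ge_zero order_trans)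
  obtain B where B: "fc_limit f A B" using fc_limit_ex[OF A rs cont] by blast
  have "continuous_on {1 - r..1 + r} (\<lambda>t. inverse (f t))"
    using cont pos r by (intro continuous_on_inverse) (auto simp: less_imp_neq[symmetric])
  then obtain C where C: "fc_limit (\<lambda>t. inverse (f t)) A C" using fc_limit_ex[OF A rs] by blast
  have fB: "fun_calc f A = B" by (rule fun_calc_eq[OF A B])
  have pos': "f t > 0" if "t \<in> real_spectrum A" for t
    using that rs r by (intro pos) auto
  have inv: "is_op_inverse B C"
    by (rule fc_limit_inverse[OF A B C]) (use pos' in \<open>auto simp: less_imp_neq[symmetric]\<close>)
  then have fC: "op_inverse (fun_calc f A) = C" unfolding fB by (rule op_inverse_eq)
  show "fc_limit f A (fun_calc f A)" using B fB by simp
  show "fc_limit (\<lambda>t. inverse (f t)) A (op_inverse (fun_calc f A))" using C fC by simp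
  have "pos_semidef B"
    using pos' by (intro fc_limit_nonneg[OF A B]) (auto simp: less_imp_le)
  then show "pos_def (fun_calc f A)" using inv fB by (auto simp: pos_def_def)
  let ?m = "inverse (f (1 + r))"
  have "?m * (norm x)\<^sup>2 \<le> inner (blinfun_apply C x) x" for x
  proof -
    have "inner (blinfun_apply (op_poly [:?m:] A) x) x \<le> inner (blinfun_apply C x) x"
    proof (rule fc_limit_ge[OF A C])
      fix t assume t: "t \<in> real_spectrum A"
      then have "f t \<le> f (1 + r)"
        using rs r by (intro operator_monotone_mono[OF om]) auto
      then show "poly [:?m:] t \<le> inverse (f t)" using pos'[OF t] by (simp add: le_imp_inverse_le)
    qed
    then show ?thesis by (simp add: blinfun.bilinear_simps power2_norm_eq_inner)
  qed
  then show "\<exists>m>0. \<forall>x. m * (norm x)\<^sup>2 \<le> inner (blinfun_apply (op_inverse (fun_calc f A)) x) x"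
    unfolding fC using pos[of "1 + r"] r0 by (intro exI[of _ ?m]) auto
qed

text \<open>Cauchy-Schwarz for the form of \<open>S\<close> at \<open>x\<close> and
  \<open>S x\<close> bounds the fourth power of \<open>norm (S x)\<close> by the product of the form
  values at these two vectors, hence by
  \<open>(norm x)\<^sup>2 * (norm (S x))\<^sup>2\<close>.\<close>

lemma norm_le_one_if_le_id:
  assumes S: "pos_semidef S" and le: "\<And>x. inner (blinfun_apply S x) x \<le> (norm x)\<^sup>2"
  shows "norm S \<le> 1"
proof (rule norm_blinfun_bound)
  fix x
  let ?y = "blinfun_apply S x"
  have "(inner ?y ?y)\<^sup>2 \<le> inner ?y x * inner (blinfun_apply S ?y) ?y"
    by (rule pos_semidef_cauchy_schwarz[OF S])
  also have "\<dots> \<le> (norm x)\<^sup>2 * (norm ?y)\<^sup>2"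
    using S by (intro mult_mono le) (auto simp: pos_semidef_iff)
  finally have "(norm ?y)\<^sup>2 * (norm ?y)\<^sup>2 \<le> (norm x)\<^sup>2 * (norm ?y)\<^sup>2"
    by (simp add: power2_norm_eq_inner[symmetric] power2_eq_square)
  then have "(norm ?y)\<^sup>2 \<le> (norm x)\<^sup>2" if "?y \<noteq> 0"
    by (rule mult_right_le_imp_le) (use that in simp)
  then show "norm ?y \<le> 1 * norm x" by (cases "?y = 0") (auto dest: power2_le_imp_le)
qed simp

text \<open>Cauchy-Schwarz for the form of \<open>K\<close> at \<open>H x\<close> and
  \<open>x\<close>: since \<open>K (H x) = x\<close>, the mixed term is \<open>inner x x\<close>,
  and the form at \<open>H x\<close> is \<open>inner x (H x)\<close>, at most
  \<open>(norm x)\<^sup>2\<close>.\<close>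

lemma id_le_if_inverse_norm_le_one:
  assumes K: "pos_semidef K" and inv: "is_op_inverse K H" and H: "norm H \<le> 1"
  shows "(norm x)\<^sup>2 \<le> inner (blinfun_apply K x) x"
proof -
  let ?y = "blinfun_apply H x"
  have y: "blinfun_apply K ?y = x"
    using inv unfolding is_op_inverse_def
    by (metis blinfun_apply_blinfun_compose blinfun_apply_id_blinfun id_apply)
  have "inner x ?y \<le> norm x * norm ?y" by (rule norm_cauchy_schwarz)
  also have "\<dots> \<le> norm x * (1 * norm x)"
    by (intro mult_left_mono order_trans[OF norm_blinfun] mult_right_mono H) auto
  finally have xy: "inner x ?y \<le> (norm x)\<^sup>2" by (simp add: power2_eq_square)
  have "(inner x x)\<^sup>2 \<le> inner x ?y * inner (blinfun_apply K x) x"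
    using pos_semidef_cauchy_schwarz[OF K, of ?y x] by (simp add: y)
  also have "\<dots> \<le> (norm x)\<^sup>2 * inner (blinfun_apply K x) x"
    using K xy by (intro mult_right_mono) (auto simp: pos_semidef_iff)
  finally have "(norm x)\<^sup>2 * (norm x)\<^sup>2 \<le> (norm x)\<^sup>2 * inner (blinfun_apply K x) x"
    by (simp add: power2_norm_eq_inner[symmetric] power2_eq_square[of "(norm x)\<^sup>2"])
  then have "(norm x)\<^sup>2 \<le> inner (blinfun_apply K x) x" if "x \<noteq> 0"
    by (rule mult_left_le_imp_le) (use that in simp)
  then show ?thesis using K by (cases "x = 0") (auto simp: pos_semidef_iff)
qed

section \<open>The equivalence\<close>

lemma arith_mean_fun_calc_le_one:
  fixes T :: "('a::complex_hilbert \<Rightarrow>\<^sub>L 'a) ^ 'n::finite"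
  assumes f: "f \<in> OM1" and T: "\<And>i. selfadjoint (T $ i)" and w: "w \<in> prob_vectors"
    and r: "0 \<le> r" "\<And>i. r * norm (T $ i) \<le> 1 / 2"
    and neg: "(\<Sum>i\<in>UNIV. (w $ i) *\<^sub>R (T $ i)) \<preceq> 0"
  shows "norm (arith_mean w (\<chi> i. fun_calc f (r *\<^sub>R (T $ i) + id_blinfun))) \<le> 1"
proof (rule norm_le_one_if_le_id)
  define A where "A i = r *\<^sub>R (T $ i) + id_blinfun" for i
  have A: "selfadjoint (A i)" for i
    unfolding A_def by (intro selfadjoint_add selfadjoint_scaleR selfadjoint_id T)
  have nA: "norm (A i - id_blinfun) \<le> 1 / 2" for i
    using r by (simp add: A_def)
  note B = OM1_fun_calc[OF f A nA, simplified]
  have w0: "w $ i \<ge> 0" for i using w by (simp add: prob_vectors_def less_imp_le)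
  have psd: "pos_semidef (fun_calc f (A i))" for i using B(2) by (simp add: pos_def_def)
  have mean: "arith_mean w (\<chi> i. fun_calc f (r *\<^sub>R (T $ i) + id_blinfun))
      = (\<Sum>i\<in>UNIV. w $ i *\<^sub>R fun_calc f (A i))"
    by (simp add: arith_mean_def A_def)
  show "pos_semidef (arith_mean w (\<chi> i. fun_calc f (r *\<^sub>R (T $ i) + id_blinfun)))"
    unfolding mean pos_semidef_iff inner_weighted_sum
    using psd w0 by (auto simp: pos_semidef_iff intro!: selfadjoint_sum selfadjoint_scaleR sum_nonneg)
  have om: "operator_monotone {0<..} f" and f1: "f 1 = 1" using f by (auto simp: OM1_def)
  obtain c where c: "\<And>t. t > 0 \<Longrightarrow> f t \<le> f 1 + c * (t - 1)"
    using operator_monotone_differentiable[OF om, of 1] by auto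
  have c0: "c \<ge> 0" using c[of 2] operator_monotone_mono[OF om, of 1 2] by simp
  fix x
  have le: "inner (blinfun_apply (fun_calc f (A i)) x) x
      \<le> (norm x)\<^sup>2 + c * r * inner (blinfun_apply (T $ i) x) x" for i
  proof -
    have "inner (blinfun_apply (fun_calc f (A i)) x) x
        \<le> inner (blinfun_apply (op_poly [:1 - c, c:] (A i)) x) x"
    proof (rule fc_limit_le[OF A B(1)])
      fix t assume "t \<in> real_spectrum (A i)"
      then have "t > 0"
        using spectrum_subset_interval[OF A, of i 1 "1 / 2"] nA by (auto simp: real_spectrum_def)
      then show "f t \<le> poly [:1 - c, c:] t" using c[of t] f1 by (simp add: algebra_simps)
    qed
    also have "\<dots> = (norm x)\<^sup>2 + c * r * inner (blinfun_apply (T $ i) x) x"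
      by (simp add: A_def blinfun.bilinear_simps inner_add_left power2_norm_eq_inner algebra_simps)
    finally show ?thesis .
  qed
  have "(\<Sum>i\<in>UNIV. w $ i * inner (blinfun_apply (fun_calc f (A i)) x) x)
      \<le> (\<Sum>i\<in>UNIV. w $ i * ((norm x)\<^sup>2 + c * r * inner (blinfun_apply (T $ i) x) x))"
    using le w0 by (intro sum_mono mult_left_mono)
  also have "\<dots> = (\<Sum>i\<in>UNIV. w $ i) * (norm x)\<^sup>2
      + c * r * (\<Sum>i\<in>UNIV. w $ i * inner (blinfun_apply (T $ i) x) x)"
    by (simp add: distrib_left sum.distrib sum_distrib_left sum_distrib_right mult_ac)
  also have "\<dots> \<le> 1 * (norm x)\<^sup>2 + c * r * 0"
  proof (intro add_mono mult_left_mono)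
    show "(\<Sum>i\<in>UNIV. w $ i * inner (blinfun_apply (T $ i) x) x) \<le> 0"
      using neg by (simp add: op_le_def pos_semidef_iff blinfun.minus_left flip: inner_weighted_sum)
  qed (use c0 r w in \<open>auto simp: prob_vectors_def\<close>)
  finally show "inner (blinfun_apply (arith_mean w (\<chi> i. fun_calc f (r *\<^sub>R (T $ i) + id_blinfun))) x) x
      \<le> (norm x)\<^sup>2"
    unfolding mean inner_weighted_sum by simp
qed

text \<open>Unlike the bound for \<open>f\<close>, the linear bound \<open>g\<close> for the
  reciprocal holds only near 1 and with an error \<open>e\<close>. The conclusion keeps the factor
  \<open>r\<close>, so that an error small compared with \<open>r\<close> disappears in the
  limit.\<close>

lemma weighted_sum_le_if_harm_mean_le_one:
  fixes T :: "('a::complex_hilbert \<Rightarrow>\<^sub>L 'a) ^ 'n::finite"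
  assumes f: "f \<in> OM1" and T: "\<And>i. selfadjoint (T $ i)" and w: "w \<in> prob_vectors"
    and r: "0 < r" "\<And>i. r * norm (T $ i) \<le> \<rho>" "\<rho> < 1"
    and g: "\<And>t. \<bar>t - 1\<bar> \<le> \<rho> \<Longrightarrow> inverse (f t) \<le> 1 - c * (t - 1) + e"
    and H: "norm (harm_mean w (\<chi> i. fun_calc f (r *\<^sub>R (T $ i) + id_blinfun))) \<le> 1"
  shows "c * r * inner (blinfun_apply (\<Sum>i\<in>UNIV. (w $ i) *\<^sub>R (T $ i)) x) x \<le> e * (norm x)\<^sup>2"
proof -
  define A where "A i = r *\<^sub>R (T $ i) + id_blinfun" for i
  have A: "selfadjoint (A i)" for i
    unfolding A_def by (intro selfadjoint_add selfadjoint_scaleR selfadjoint_id T)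
  have nA: "norm (A i - id_blinfun) \<le> \<rho>" for i
    using r by (simp add: A_def)
  note B = OM1_fun_calc[OF f A nA r(3)]
  have w0: "w $ i > 0" and w1: "(\<Sum>i\<in>UNIV. w $ i) = 1" for i using w by (simp_all add: prob_vectors_def)
  define G where "G i = op_inverse (fun_calc f (A i))" for i
  define K where "K = (\<Sum>i\<in>UNIV. w $ i *\<^sub>R G i)"
  have Gsa: "selfadjoint (G i)" for i
    unfolding G_def by (rule fc_limit_selfadjoint[OF A B(3)])
  have Ksa: "selfadjoint K" unfolding K_def by (intro selfadjoint_sum selfadjoint_scaleR Gsa)
  have "\<forall>i. \<exists>m>0. \<forall>x. m * (norm x)\<^sup>2 \<le> inner (blinfun_apply (G i) x) x"
    using B(4) by (simp add: G_def)
  then obtain m where m: "\<And>i. m i > 0" "\<And>i x. m i * (norm x)\<^sup>2 \<le> inner (blinfun_apply (G i) x) x"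
    by metis
  \<comment> \<open>A coercivity constant of \<open>K\<close>. It provides an inverse of
    \<open>K\<close>, with which the \<open>THE\<close> in \<open>harm_mean\<close> is then
    identified.\<close>
  define k where "k = (\<Sum>i\<in>UNIV. w $ i * m i)"
  have k: "k > 0" unfolding k_def using w0 m(1) by (intro sum_pos) auto
  have Kk: "k * (norm x)\<^sup>2 \<le> inner (blinfun_apply K x) x" for x
    unfolding k_def K_def inner_weighted_sum sum_distrib_right
    using m(2) w0 by (intro sum_mono) (simp add: mult.assoc less_imp_le)
  obtain H' where H': "is_op_inverse K H'"
    using clinear_op_inverse_ex[OF selfadjoint_clinear[OF Ksa] k Kk] by blast
  have "harm_mean w (\<chi> i. fun_calc f (r *\<^sub>R (T $ i) + id_blinfun)) = H'"
    using op_inverse_eq[OF H'] by (simp add: harm_mean_def K_def G_def A_def)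
  then have nH: "norm H' \<le> 1" using H by simp
  have "pos_semidef K"
    unfolding pos_semidef_iff using Ksa Kk k by (meson less_imp_le mult_nonneg_nonneg order_trans zero_le_power2)
  then have ge: "(norm x)\<^sup>2 \<le> inner (blinfun_apply K x) x"
    using H' nH by (rule id_le_if_inverse_norm_le_one)
  have le: "inner (blinfun_apply (G i) x) x
      \<le> (1 + e) * (norm x)\<^sup>2 - c * r * inner (blinfun_apply (T $ i) x) x" for i
  proof -
    have "inner (blinfun_apply (G i) x) x
        \<le> inner (blinfun_apply (op_poly [:1 + c + e, - c:] (A i)) x) x"
      unfolding G_def
    proof (rule fc_limit_le[OF A B(3)])
      fix t assume "t \<in> real_spectrum (A i)"
      then have "\<bar>t - 1\<bar> \<le> \<rho>"
        using spectrum_subset_interval[OF A, of i 1 \<rho>] nA by (auto simp: real_spectrum_def abs_le_iff)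
      then show "inverse (f t) \<le> poly [:1 + c + e, - c:] t" using g[of t] by (simp add: algebra_simps)
    qed
    also have "\<dots> = (1 + e) * (norm x)\<^sup>2 - c * r * inner (blinfun_apply (T $ i) x) x"
      by (simp add: A_def blinfun.bilinear_simps inner_add_left power2_norm_eq_inner algebra_simps)
    finally show ?thesis .
  qed
  have "inner (blinfun_apply K x) x
      \<le> (\<Sum>i\<in>UNIV. w $ i * ((1 + e) * (norm x)\<^sup>2 - c * r * inner (blinfun_apply (T $ i) x) x))"
    unfolding K_def inner_weighted_sum using le w0 by (intro sum_mono mult_left_mono) (auto simp: less_imp_le)
  also have "\<dots> = (\<Sum>i\<in>UNIV. w $ i) * ((1 + e) * (norm x)\<^sup>2)
      - c * r * inner (blinfun_apply (\<Sum>i\<in>UNIV. (w $ i) *\<^sub>R (T $ i)) x) x"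
    unfolding inner_weighted_sum
    by (simp add: right_diff_distrib sum_subtractf sum_distrib_left sum_distrib_right mult_ac)
  finally show ?thesis using ge by (simp add: w1 algebra_simps)
qed

theorem theorem4:
  fixes f :: "real \<Rightarrow> real"
    and \<Phi> :: "real ^ 'n::finite \<Rightarrow> ('a::complex_hilbert \<Rightarrow>\<^sub>L 'a) ^ 'n \<Rightarrow> 'a \<Rightarrow> real"
    and T :: "('a \<Rightarrow>\<^sub>L 'a) ^ 'n"
    and w :: "real ^ 'n"
  assumes "\<exists>x::'a. x \<noteq> 0"
    and "CARD('n) \<ge> 2"
    and "f \<in> OM1"
    and "\<not> f constant_on {0<..}"
    and "\<And>\<omega> A x. \<omega> \<in> prob_vectors \<Longrightarrow> (\<forall>i. pos_def (A $ i)) \<Longrightarrow> 0 \<le> \<Phi> \<omega> A x"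
    and "\<And>\<omega> A. \<omega> \<in> prob_vectors \<Longrightarrow> (\<forall>i. pos_def (A $ i)) \<Longrightarrow>
           ereal (norm (harm_mean \<omega> A)) \<le> (SUP x\<in>{x. norm x = 1}. ereal (\<Phi> \<omega> A x))"
    and "\<And>\<omega> A. \<omega> \<in> prob_vectors \<Longrightarrow> (\<forall>i. pos_def (A $ i)) \<Longrightarrow>
           (SUP x\<in>{x. norm x = 1}. ereal (\<Phi> \<omega> A x)) \<le> ereal (norm (arith_mean \<omega> A))"
    and "\<forall>i. selfadjoint (T $ i)"
    and "w \<in> prob_vectors"
  shows "(\<Sum>i\<in>UNIV. (w $ i) *\<^sub>R (T $ i)) \<preceq> 0 \<longleftrightarrow>
    (\<exists>r0>0. \<forall>r\<in>{0..r0}.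
       (\<forall>i. spectrum (r *\<^sub>R (T $ i) + id_blinfun) \<subseteq> complex_of_real ` {0<..}) \<and>
       (\<forall>x. norm x = 1 \<longrightarrow>
          \<Phi> w (\<chi> i. fun_calc f (r *\<^sub>R (T $ i) + id_blinfun)) x \<le> 1))"
proof -
  note f = \<open>f \<in> OM1\<close> and w = \<open>w \<in> prob_vectors\<close>
  have T: "selfadjoint (T $ i)" for i using \<open>\<forall>i. selfadjoint (T $ i)\<close> by simp
  define M where "M = (\<Sum>i\<in>UNIV. norm (T $ i))"
  have M: "norm (T $ i) \<le> M" for i unfolding M_def by (rule member_le_sum) auto
  have M0: "M \<ge> 0" unfolding M_def by (intro sum_nonneg) auto
  \<comment> \<open>Chosen for \<open>r * M \<le> 1 / 2\<close>, which confines all spectra to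
    \<open>{1/2..3/2}\<close>; adding 1 avoids division by zero when every \<open>T $ i\<close>
    vanishes.\<close>
  define r1 where "r1 = 1 / (2 * (M + 1))"
  have r1: "r1 > 0" using M0 by (simp add: r1_def)
  have small: "r * norm (T $ i) \<le> r * M" "r * M \<le> 1 / 2" if "0 \<le> r" "r \<le> r1" for r i
  proof -
    show "r * norm (T $ i) \<le> r * M" using that M by (intro mult_left_mono)
    have "r * M \<le> r1 * (M + 1)" using that M0 by (intro mult_mono) auto
    also have "\<dots> = 1 / 2" using M0 by (simp add: r1_def field_simps)
    finally show "r * M \<le> 1 / 2" .
  qed
  have sa: "selfadjoint (r *\<^sub>R (T $ i) + id_blinfun)" for r i
    by (intro selfadjoint_add selfadjoint_scaleR selfadjoint_id T)
  have near: "norm (r *\<^sub>R (T $ i) + id_blinfun - id_blinfun) \<le> 1 / 2" if "0 \<le> r" "r \<le> r1" for r i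
    using order_trans[OF small(1)[OF that, of i] small(2)[OF that]] that by simp
  have pd: "\<forall>i. pos_def ((\<chi> i. fun_calc f (r *\<^sub>R (T $ i) + id_blinfun)) $ i)" if "0 \<le> r" "r \<le> r1" for r
    using OM1_fun_calc(2)[OF f sa near[OF that]] by simp
  show ?thesis
  proof
    assume neg: "(\<Sum>i\<in>UNIV. (w $ i) *\<^sub>R (T $ i)) \<preceq> 0"
    show "\<exists>r0>0. \<forall>r\<in>{0..r0}.
       (\<forall>i. spectrum (r *\<^sub>R (T $ i) + id_blinfun) \<subseteq> complex_of_real ` {0<..}) \<and>
       (\<forall>x. norm x = 1 \<longrightarrow> \<Phi> w (\<chi> i. fun_calc f (r *\<^sub>R (T $ i) + id_blinfun)) x \<le> 1)"
    proof (intro exI[of _ r1] conjI ballI allI impI r1)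
      fix r i assume "r \<in> {0..r1}"
      then have r: "0 \<le> r" "r \<le> r1" by auto
      have "spectrum (r *\<^sub>R (T $ i) + id_blinfun) \<subseteq> complex_of_real ` {1 - 1 / 2..1 + 1 / 2}"
        using near[OF r, of i] by (intro spectrum_subset_interval sa) simp
      also have "\<dots> \<subseteq> complex_of_real ` {0<..}" by (intro image_mono) auto
      finally show "spectrum (r *\<^sub>R (T $ i) + id_blinfun) \<subseteq> complex_of_real ` {0<..}" .
    next
      fix r x assume "r \<in> {0..r1}" and x: "norm (x::'a) = 1"
      then have r: "0 \<le> r" "r \<le> r1" by auto
      let ?A = "\<chi> i. fun_calc f (r *\<^sub>R (T $ i) + id_blinfun)"
      have "ereal (\<Phi> w ?A x) \<le> (SUP x\<in>{x. norm x = 1}. ereal (\<Phi> w ?A x))"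
        using x by (intro SUP_upper) auto
      also have "\<dots> \<le> ereal (norm (arith_mean w ?A))"
        using assms(7)[OF w pd[OF r]] .
      also have "norm (arith_mean w ?A) \<le> 1"
        using small[OF r] by (intro arith_mean_fun_calc_le_one f T w r neg) (meson order_trans)
      finally show "\<Phi> w ?A x \<le> 1" by simp
    qed
  next
    assume "\<exists>r0>0. \<forall>r\<in>{0..r0}.
       (\<forall>i. spectrum (r *\<^sub>R (T $ i) + id_blinfun) \<subseteq> complex_of_real ` {0<..}) \<and>
       (\<forall>x. norm x = 1 \<longrightarrow> \<Phi> w (\<chi> i. fun_calc f (r *\<^sub>R (T $ i) + id_blinfun)) x \<le> 1)"
    then obtain r0 where r0: "r0 > 0" and le1: "\<And>r x. 0 \<le> r \<Longrightarrow> r \<le> r0 \<Longrightarrow> norm x = 1 \<Longrightarrow>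
        \<Phi> w (\<chi> i. fun_calc f (r *\<^sub>R (T $ i) + id_blinfun)) x \<le> 1" by auto
    have om: "operator_monotone {0<..} f" and f1: "f 1 = 1" using f by (auto simp: OM1_def)
    obtain c where c: "\<And>t. t > 0 \<Longrightarrow> f t \<le> f 1 + c * (t - 1)" "(f has_real_derivative c) (at 1)"
      using operator_monotone_differentiable[OF om, of 1] by auto
    have c0: "c > 0" by (rule operator_monotone_positive_slope[OF om _ assms(4) c(1)]) auto
    have "((\<lambda>t. inverse (f t)) has_real_derivative - c) (at 1)"
      using DERIV_inverse'[OF c(2)] f1 by simp
    then have g: "\<exists>\<delta>>0. \<forall>t. \<bar>t - 1\<bar> < \<delta> \<longrightarrow> \<bar>inverse (f t) - 1 + c * (t - 1)\<bar> \<le> \<epsilon> * \<bar>t - 1\<bar>"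
      if "\<epsilon> > 0" for \<epsilon>
      using that f1 unfolding has_field_derivative_def has_derivative_at_alt by simp
    define S where "S = (\<Sum>i\<in>UNIV. (w $ i) *\<^sub>R (T $ i))"
    have "inner (blinfun_apply S x) x \<le> 0" for x
    proof (rule field_le_epsilon)
      fix e :: real assume e: "e > 0"
      \<comment> \<open>Scaled so that \<open>\<epsilon> * (M * (norm x)\<^sup>2)\<close> is at most
        \<open>c * e\<close>; the 1 covers a zero denominator.\<close>
      define \<epsilon> where "\<epsilon> = c * e / (M * (norm x)\<^sup>2 + 1)"
      have den: "M * (norm x)\<^sup>2 + 1 > 0" using M0 by (simp add: add_nonneg_pos)
      then have \<epsilon>: "\<epsilon> > 0" using e c0 by (simp add: \<epsilon>_def)
      obtain \<delta> where \<delta>: "\<delta> > 0"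
        "\<And>t. \<bar>t - 1\<bar> < \<delta> \<Longrightarrow> \<bar>inverse (f t) - 1 + c * (t - 1)\<bar> \<le> \<epsilon> * \<bar>t - 1\<bar>"
        using g[OF \<epsilon>] by blast
      \<comment> \<open>The last term gives \<open>r * M < \<delta>\<close>, so every spectrum lies
        where the expansion of the reciprocal is valid.\<close>
      define r where "r = min (min r0 r1) (\<delta> / (M + 1))"
      have r: "r > 0" "r \<le> r0" "r \<le> r1" using r0 r1 \<delta> M0 by (auto simp: r_def)
      have "r * M < r * (M + 1)" using r by simp
      also have "\<dots> \<le> \<delta> / (M + 1) * (M + 1)" using M0 by (intro mult_right_mono) (auto simp: r_def)
      finally have rM: "r * M < \<delta>" using M0 by simp
      let ?A = "\<chi> i. fun_calc f (r *\<^sub>R (T $ i) + id_blinfun)"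
      have "ereal (norm (harm_mean w ?A)) \<le> (SUP x\<in>{x. norm x = 1}. ereal (\<Phi> w ?A x))"
        using assms(6)[OF w pd] r by simp
      also have "\<dots> \<le> ereal 1"
        using le1 r by (intro SUP_least) auto
      finally have H: "norm (harm_mean w ?A) \<le> 1" by simp
      have "c * r * inner (blinfun_apply S x) x \<le> (\<epsilon> * (r * M)) * (norm x)\<^sup>2"
        unfolding S_def
      proof (rule weighted_sum_le_if_harm_mean_le_one[OF f T w r(1) _ _ _ H])
        show "r * norm (T $ i) \<le> r * M" for i using small r by simp
        show "r * M < 1" using small(2)[of r] r by simp
        fix t assume t: "\<bar>t - 1\<bar> \<le> r * M"
        then have "\<epsilon> * \<bar>t - 1\<bar> \<le> \<epsilon> * (r * M)" using \<epsilon> by (intro mult_left_mono) auto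
        then show "inverse (f t) \<le> 1 - c * (t - 1) + \<epsilon> * (r * M)"
          using \<delta>(2)[of t] t rM by linarith
      qed
      \<comment> \<open>The error is itself proportional to \<open>r\<close>, which cancels.\<close>
      then have "r * (c * inner (blinfun_apply S x) x) \<le> r * (\<epsilon> * (M * (norm x)\<^sup>2))"
        by (simp add: mult_ac)
      then have "c * inner (blinfun_apply S x) x \<le> \<epsilon> * (M * (norm x)\<^sup>2)"
        using r(1) by simp
      also have "\<dots> \<le> \<epsilon> * (M * (norm x)\<^sup>2 + 1)" using \<epsilon> by (intro mult_left_mono) auto
      also have "\<dots> = c * e" using den by (simp add: \<epsilon>_def)
      finally show "inner (blinfun_apply S x) x \<le> 0 + e" using c0 by simp
    qed
    moreover have "selfadjoint S" unfolding S_def by (intro selfadjoint_sum selfadjoint_scaleR T)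
    ultimately show "(\<Sum>i\<in>UNIV. (w $ i) *\<^sub>R (T $ i)) \<preceq> 0"
      unfolding S_def[symmetric] op_le_def pos_semidef_iff
      by (auto intro: selfadjoint_diff[OF selfadjoint_0, simplified] simp: blinfun.minus_left)
  qed
qed

end
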